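(* If $A$ is a $2\times 2$ expanding, non-diagonalizable (over $\mathbb{C}$) integer matrix, then the induced expanding toral endomorphism $f_A:\mathbb{T}^2\to\mathbb{T}^2$ admits a hybrid Markov partition.
   Context: A $d\times d$ integer matrix $A$ is expanding if all its (complex) eigenvalues have modulus strictly greater than $1$. It induces the expanding toral endomorphism $f_A:\mathbb{T}^d\to\mathbb{T}^d$, $\mathbb{T}^d=\mathbb{R}^d/\mathbb{Z}^d$, $f_A(x+\mathbb{Z}^d)=Ax+\mathbb{Z}^d$. The torus carries the standard quotient metric induced by the Euclidean metric. A set $R$ in a compact metric space $X$ is proper if $R=\overline{\operatorname{int}(R)}\neq\emptyset$. A Markov partition for a positively expansive system $(X,f)$ is a finite cover $\mathcal{M}=\{R_i\}_{i=1}^n$ of $X$ by proper sets with pairwise disjoint interiors such that: (1) (metrically generating) for all $(x_k)_{k\ge 0}\in\{1,\dots,n\}^{\mathbb{N}}$, the set $\bigcap_{k=0}^\infty f^{-k}(\operatorname{int}(R_{x_k}))$ consists of at most one point; (2) (Markov property) for all $R,R'\in\mathcal{M}$, if $f(\operatorname{int}(R))\cap\operatorname{int}(R')\neq\emptyset$, then each $y\in\operatorname{int}(R')$ has a unique preimage under $f$ in $R$. (Every expanding toral endomorphism is positively expansive.) The boundary of $\mathcal{M}$ is $\partial\mathcal{M}:=\bigcup_{R\in\mathcal{M}}\partial R$. A Markov partition $\mathcal{M}$ of an expanding toral endomorphism on $\mathbb{T}^2$ is hybrid if $\partial\mathcal{M}$ is not piecewise $C^1$ (not a finite union of $C^1$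 arcs), but contains a $C^1$ arc. A $C^1$ arc is the image of an injective $C^1$ map $[0,1]\to\mathbb{T}^2$ with nowhere vanishing derivative. *)

theory Defs
  imports "HOL-Analysis.Analysis"
begin

section \<open>The torus\<close>

definition int_lattice :: "(real ^ 'n::finite) set" where
  "int_lattice = {z. \<forall>i. z $ i \<in> \<int>}"

lemma int_lattice_0 [simp]: "0 \<in> int_lattice"
  by (simp add: int_lattice_def)

lemma int_lattice_add: "a \<in> int_lattice \<Longrightarrow> b \<in> int_lattice \<Longrightarrow> a + b \<in> int_lattice"
  by (simp add: int_lattice_def)

lemma int_lattice_diff: "a \<in> int_lattice \<Longrightarrow> b \<in> int_lattice \<Longrightarrow> a - b \<in> int_lattice"
  by (simp add: int_lattice_def)

lemma int_lattice_minus: "a \<in> int_lattice \<Longrightarrow> - a \<in> int_lattice"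
  by (simp add: int_lattice_def)

lemma closed_int_lattice: "closed (int_lattice :: (real ^ 'n::finite) set)"
proof -
  have "closed ((\<lambda>z :: real ^ 'n. z $ i) -` \<int>)" for i
    by (intro closed_vimage continuous_intros closed_Ints)
  then have "closed (\<Inter>i. (\<lambda>z :: real ^ 'n. z $ i) -` \<int>)"
    by (intro closed_INT) blast
  moreover have "int_lattice = (\<Inter>i. (\<lambda>z :: real ^ 'n. z $ i) -` \<int>)"
    by (auto simp: int_lattice_def)
  ultimately show ?thesis by simp
qed

quotient_type 'n torus = "real ^ ('n :: finite)" / "\<lambda>x y. x - y \<in> int_lattice"
  morphisms rep_torus torus_proj
proof (rule equivpI)
  show "reflp (\<lambda>x y :: real ^ 'n. x - y \<in> int_lattice)"
    by (simp add: reflp_def)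
  show "symp (\<lambda>x y :: real ^ 'n. x - y \<in> int_lattice)"
    using int_lattice_minus by (fastforce simp: symp_def)
  show "transp (\<lambda>x y :: real ^ 'n. x - y \<in> int_lattice)"
    using int_lattice_add by (fastforce simp: transp_def)
qed

lemma int_lattice_nonempty [simp]: "int_lattice \<noteq> {}"
  using int_lattice_0 by blast

lemma infdist_lattice_add:
  fixes u :: "real ^ 'n::finite"
  assumes "a \<in> int_lattice"
  shows "infdist (u + a) int_lattice = infdist u int_lattice"
proof -
  have le: "infdist v (int_lattice :: (real ^ 'n) set) \<le> infdist (v + b) int_lattice"
    if b: "b \<in> int_lattice" for v b
  proof -
    have "infdist v int_lattice \<le> dist (v + b) c" if "c \<in> int_lattice" for c
    proof -
      have "infdist v int_lattice \<le> dist v (c - b)"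
        using b that by (intro infdist_le int_lattice_diff)
      also have "\<dots> = dist (v + b) c"
        by (simp add: dist_norm algebra_simps)
      finally show ?thesis .
    qed
    then show ?thesis
      unfolding infdist_def[of "v + b"]
      by (auto intro!: cINF_greatest)
  qed
  show ?thesis
    using le[OF assms, of u] le[OF int_lattice_minus[OF assms], of "u + a"] by simp
qed

lemma infdist_lattice_minus:
  fixes u :: "real ^ 'n::finite"
  shows "infdist (- u) int_lattice = infdist u int_lattice"
proof -
  have le: "infdist (- v) int_lattice \<le> infdist v int_lattice" for v :: "real ^ 'n"
  proof -
    have "infdist (- v) int_lattice \<le> dist v c" if "c \<in> int_lattice" for c
    proof -
      have "infdist (- v) int_lattice \<le> dist (- v) (- c)"
        using that by (intro infdist_le int_lattice_minus)
      also have "\<dots> = dist v c"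
        by (simp add: dist_norm norm_minus_commute)
      finally show ?thesis .
    qed
    then show ?thesis
      unfolding infdist_def[of v]
      by (auto intro!: cINF_greatest)
  qed
  show ?thesis
    using le[of u] le[of "- u"] by simp
qed

lemma infdist_lattice_triangle:
  fixes x y z :: "real ^ 'n::finite"
  shows "infdist (x - z) int_lattice \<le> infdist (x - y) int_lattice + infdist (y - z) int_lattice"
proof -
  have "infdist (x - z) int_lattice - infdist (y - z) int_lattice \<le> dist (x - y) a"
    if "a \<in> int_lattice" for a
  proof -
    have "infdist (x - z) int_lattice = infdist (x - z - a) int_lattice"
      using infdist_lattice_add[OF int_lattice_minus[OF that], of "x - z"] by simp
    also have "\<dots> \<le> infdist (y - z) int_lattice + dist (x - z - a) (y - z)"
      by (rule infdist_triangle)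
    also have "dist (x - z - a) (y - z) = dist (x - y) a"
      by (simp add: dist_norm algebra_simps)
    finally show ?thesis by simp
  qed
  then have "infdist (x - z) int_lattice - infdist (y - z) int_lattice
      \<le> infdist (x - y) int_lattice"
    unfolding infdist_def[of "x - y"]
    by (auto intro!: cINF_greatest)
  then show ?thesis by simp
qed

instantiation torus :: (finite) metric_space
begin

text \<open>The quotient metric: the distance of \<open>x + \<int>\<^sup>n\<close> and \<open>y + \<int>\<^sup>n\<close> is the infimum of the
  Euclidean distances between representatives, that is, the distance of \<open>x - y\<close> from \<open>\<int>\<^sup>n\<close>.\<close>

lift_definition dist_torus :: "'a torus \<Rightarrow> 'a torus \<Rightarrow> real"
  is "\<lambda>x y. infdist (x - y) int_lattice"
proof -
  fix x x' y y' :: "real ^ 'a"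
  assume "x - x' \<in> int_lattice" "y - y' \<in> int_lattice"
  then have "(x - x') - (y - y') \<in> int_lattice"
    by (rule int_lattice_diff)
  from infdist_lattice_add[OF this, of "x' - y'"]
  show "infdist (x - y) int_lattice = infdist (x' - y') int_lattice"
    by (simp add: algebra_simps)
qed

definition uniformity_torus :: "('a torus \<times> 'a torus) filter" where
  "uniformity_torus = (INF e\<in>{0<..}. principal {(x, y). dist x y < e})"

definition open_torus :: "'a torus set \<Rightarrow> bool" where
  "open_torus U \<longleftrightarrow> (\<forall>x\<in>U. \<forall>\<^sub>F (x', y) in uniformity. x' = x \<longrightarrow> y \<in> U)"

instance
proof
  show "uniformity = (INF e\<in>{0<..}. principal {(x, y :: 'a torus). dist x y < e})"
    by (rule uniformity_torus_def)
  show "open U \<longleftrightarrow> (\<forall>x\<in>U. \<forall>\<^sub>F (x', y) in uniformity. x' = x \<longrightarrow> y \<in> U)" for U :: "'a torus set"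
    by (rule open_torus_def)
  show "dist x y = 0 \<longleftrightarrow> x = y" for x y :: "'a torus"
  proof transfer
    fix x y :: "real ^ 'a"
    show "infdist (x - y) int_lattice = 0 \<longleftrightarrow> x - y \<in> int_lattice"
      using in_closed_iff_infdist_zero[OF closed_int_lattice int_lattice_nonempty, of "x - y"]
      by simp
  qed
  show "dist x y \<le> dist x z + dist y z" for x y z :: "'a torus"
  proof transfer
    fix x y z :: "real ^ 'a"
    show "infdist (x - y) int_lattice
        \<le> infdist (x - z) int_lattice + infdist (y - z) int_lattice"
      using infdist_lattice_triangle[of x y z] infdist_lattice_minus[of "y - z"] by simp
  qed
qed

end


section \<open>Expanding toral endomorphisms\<close>

definition expanding_matrix :: "int ^ 'n ^ 'n::finite \<Rightarrow> bool" where
  "expanding_matrix A \<longleftrightarrow>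
     (\<forall>(c :: complex) v. v \<noteq> 0 \<and> map_matrix of_int A *v v = c *s v \<longrightarrow> cmod c > 1)"

definition diagonalizable_over_complex :: "int ^ 'n ^ 'n::finite \<Rightarrow> bool" where
  "diagonalizable_over_complex A \<longleftrightarrow>
     (\<exists>P :: complex ^ 'n ^ 'n. invertible P \<and>
        (\<forall>i j. i \<noteq> j \<longrightarrow> (matrix_inv P ** map_matrix of_int A ** P) $ i $ j = 0))"

lift_definition toral_endo :: "int ^ 'n ^ 'n \<Rightarrow> 'n::finite torus \<Rightarrow> 'n torus"
  is "\<lambda>A x. map_matrix real_of_int A *v x"
proof -
  fix A :: "int ^ 'n ^ 'n" and x y :: "real ^ 'n"
  assume "x - y \<in> int_lattice"
  then have "map_matrix real_of_int A *v (x - y) \<in> int_lattice"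
    by (auto simp: int_lattice_def matrix_vector_mult_def intro!: Ints_sum Ints_mult)
  then show "map_matrix real_of_int A *v x - map_matrix real_of_int A *v y \<in> int_lattice"
    by (simp add: matrix_vector_mult_diff_distrib)
qed


section \<open>Markov partitions\<close>

definition proper_set :: "'a::topological_space set \<Rightarrow> bool" where
  "proper_set R \<longleftrightarrow> R = closure (interior R) \<and> R \<noteq> {}"

text \<open>The ambient space is the whole type. The partition is a set rather than an indexed family:
  since its members have nonempty, pairwise disjoint interiors, an enumeration
  \<open>R\<^sub>1, \<dots>, R\<^sub>n\<close> has no repetitions, and index sequences correspond to sequences in \<open>M\<close>.\<close>

definition markov_partition :: "('a::metric_space \<Rightarrow> 'a) \<Rightarrow> 'a set set \<Rightarrow> bool" where
  "markov_partition f M \<longleftrightarrow>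
     finite M \<and> \<Union>M = UNIV \<and>
     (\<forall>R\<in>M. proper_set R) \<and>
     (\<forall>R\<in>M. \<forall>R'\<in>M. R \<noteq> R' \<longrightarrow> interior R \<inter> interior R' = {}) \<and>
     (\<forall>x :: nat \<Rightarrow> 'a set. (\<forall>k. x k \<in> M) \<longrightarrow>
        (\<forall>p q. p \<in> (\<Inter>k. (f ^^ k) -` interior (x k)) \<and>
               q \<in> (\<Inter>k. (f ^^ k) -` interior (x k)) \<longrightarrow> p = q)) \<and>
     (\<forall>R\<in>M. \<forall>R'\<in>M. f ` interior R \<inter> interior R' \<noteq> {} \<longrightarrow>
        (\<forall>y\<in>interior R'. \<exists>!z. z \<in> R \<and> f z = y))"

definition partition_boundary :: "'a::topological_space set set \<Rightarrow> 'a set" where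
  "partition_boundary M = (\<Union>R\<in>M. frontier R)"


section \<open>Smooth arcs in the torus\<close>

text \<open>The tangent spaces of the torus are identified with \<open>\<real>\<^sup>n\<close> through the covering
  \<open>torus_proj\<close>: a curve has derivative \<open>v\<close> at \<open>t\<close> if some local lift of it has derivative \<open>v\<close> at \<open>t\<close>.
  As lifts that are continuous at \<open>t\<close> differ near \<open>t\<close> by a constant lattice vector, \<open>v\<close> does not
  depend on the lift.\<close>

definition torus_has_derivative ::
    "(real \<Rightarrow> 'n::finite torus) \<Rightarrow> real ^ 'n \<Rightarrow> real \<Rightarrow> real set \<Rightarrow> bool" where
  "torus_has_derivative g v t S \<longleftrightarrow>
     (\<exists>h. g t = torus_proj (h t) \<and>
          (\<forall>\<^sub>F s in at t within S. g s = torus_proj (h s)) \<and>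
          (h has_vector_derivative v) (at t within S))"

definition C1_arc :: "'n::finite torus set \<Rightarrow> bool" where
  "C1_arc C \<longleftrightarrow>
     (\<exists>g g'. inj_on g {0..1} \<and> C = g ` {0..1} \<and>
        continuous_on {0..1} g' \<and>
        (\<forall>t\<in>{0..1}. torus_has_derivative g (g' t) t {0..1} \<and> g' t \<noteq> 0))"

definition piecewise_C1 :: "'n::finite torus set \<Rightarrow> bool" where
  "piecewise_C1 B \<longleftrightarrow> (\<exists>F. finite F \<and> (\<forall>C\<in>F. C1_arc C) \<and> B = \<Union>F)"

definition hybrid_markov_partition :: "(2 torus \<Rightarrow> 2 torus) \<Rightarrow> 2 torus set set \<Rightarrow> bool" where
  "hybrid_markov_partition f M \<longleftrightarrow>
     markov_partition f M \<and>
     \<not> piecewise_C1 (partition_boundary M) \<and>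
     (\<exists>C. C1_arc C \<and> C \<subseteq> partition_boundary M)"

end

theory Submission
  imports Defs
begin

text \<open>
  An expanding non-diagonalizable matrix \<open>A\<close> has a double eigenvalue \<open>\<lambda>\<close>, which is an integer with
  \<open>\<bar>\<lambda>\<bar> \<ge> 2\<close>. In a suitable basis \<open>u, v\<close> of \<open>\<int>\<^sup>2\<close> it is the shear \<open>(x, y) \<mapsto> (\<lambda>x + my, \<lambda>y)\<close> with an
  integer \<open>m \<noteq> 0\<close>. The rectangles of the product map \<open>(\<lambda>x, \<lambda>y)\<close> form a Markov partition, so the aim
  is to remove the shear. The \<open>1\<close>-periodic sawtooth series
  \<open>s(y) = - (m/\<lambda>) \<Sum>\<^sub>k \<lambda>\<^sup>-\<^sup>k frac(\<lambda>\<^sup>k y)\<close> satisfies \<open>s(\<lambda>y) = \<lambda> s(y) + m frac(y)\<close>, hence in the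
  coordinates \<open>(x - s(y), y)\<close> the endomorphism acts modulo \<open>1\<close> as multiplication by \<open>\<lambda>\<close>
  (\<open>straighten\<close>). No continuous \<open>s\<close> can do this, as the degrees of the two sides of the equation
  would differ by \<open>m\<close>; the jumps of \<open>s\<close> at the \<open>\<lambda>\<close>-adic points are what makes the partition hybrid.

  The elements of the partition are the closures of the sets of points whose straightened
  coordinates are non-adic and lie in a given open square of side \<open>\<bar>\<lambda>\<bar>\<^sup>-\<^sup>n\<close>. At non-adic \<open>y\<close> the function
  \<open>s\<close> is continuous, so a generic point lies in one such closure only, which makes the closures
  proper with disjoint interiors (\<open>dense_tiling\<close>). A square is mapped onto a union of squares, and
  by compactness the same holds for the closures. For large \<open>n\<close> the oscillation of \<open>s\<close> on an adic
  interval of length \<open>\<bar>\<lambda>\<bar>\<^sup>-\<^sup>n\<close> is small (\<open>saw_oscillation\<close>), so that the closures have small diameter: the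
  endomorphism is then injective on each of them, and by expansion two points with the same
  itinerary coincide (\<open>markov\<close>).

  The boundary contains the circle \<open>y = 0\<close>, which is smooth. At an adic point of order \<open>k\<close> the
  series jumps by \<open>\<bar>m\<bar> \<bar>\<lambda>\<bar>\<^sup>-\<^sup>k / (\<bar>\<lambda>\<bar> - 1)\<close>, and for large \<open>k\<close> the boundary contains a horizontal segment of this length.
  There are of the order of \<open>\<bar>\<lambda>\<bar>\<^sup>k\<close> such points, so every large \<open>k\<close> contributes the same total length and the
  boundary has infinite length, whereas a finite union of \<open>C\<^sup>1\<close> arcs has finite length. In order to
  avoid measures, length is replaced by the number of points at mutual distance at least \<open>\<epsilon>\<close>: it is
  \<open>O(1/\<epsilon>)\<close> on a Lipschitz curve (\<open>card_separated_on_Lipschitz_curve\<close>), but of larger order on the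
  boundary (\<open>separated_sets_in_boundary\<close>).
\<close>

section \<open>Partitions from a dense family of tiles\<close>

text \<open>
  Disjointness is required only in the form that the closure of a tile misses the other tiles;
  since the tiles together are dense, this makes their closures a cover by regular closed sets with
  disjoint interiors.
\<close>
locale dense_tiling =
  fixes I :: "'i set" and P :: "'i \<Rightarrow> 'a::topological_space set"
  assumes finite_I: "finite I"
    and dense: "closure (\<Union>i\<in>I. P i) = UNIV"
    and separated: "i \<in> I \<Longrightarrow> j \<in> I \<Longrightarrow> i \<noteq> j \<Longrightarrow> closure (P i) \<inter> P j = {}"
begin

lemma Union_closure_tiles: "(\<Union>i\<in>I. closure (P i)) = UNIV"
proof -
  have "closure (\<Union>i\<in>I. P i) \<subseteq> (\<Union>i\<in>I. closure (P i))"
    using finite_I by (intro closure_minimal closed_UN UN_mono closure_subset) auto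
  then show ?thesis using dense by auto
qed

text \<open>
  The complement of the other closures is an open set around the tile, and it lies inside the
  closure of the tile because the closures cover.
\<close>
lemma tile_subset_interior:
  assumes "i \<in> I" shows "P i \<subseteq> interior (closure (P i))"
proof (rule interior_maximal[THEN order_trans[rotated]])
  let ?U = "- (\<Union>j\<in>I - {i}. closure (P j))"
  show "open ?U" using finite_I by (intro open_Compl closed_UN) auto
  show "?U \<subseteq> closure (P i)" using Union_closure_tiles by auto
  show "P i \<subseteq> ?U" using separated assms by fastforce
qed

lemma interior_meets_tile:
  assumes "open U" "U \<noteq> {}" obtains i where "i \<in> I" "U \<inter> P i \<noteq> {}"
proof -
  have "U \<inter> (\<Union>i\<in>I. P i) \<noteq> {}"
    using assms dense open_Int_closure_eq_empty[of U "\<Union>i\<in>I. P i"] by auto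
  then show ?thesis using that by auto
qed

lemma proper_closure_tile:
  assumes "i \<in> I" shows "closure (P i) = closure (interior (closure (P i)))"
proof (rule antisym)
  show "closure (P i) \<subseteq> closure (interior (closure (P i)))"
    using tile_subset_interior[OF assms] by (rule closure_mono)
  show "closure (interior (closure (P i))) \<subseteq> closure (P i)"
    by (intro closure_minimal interior_subset closed_closure)
qed

lemma disjoint_interiors:
  assumes "i \<in> I" "j \<in> I" "i \<noteq> j"
  shows "interior (closure (P i)) \<inter> interior (closure (P j)) = {}"
proof (rule ccontr)
  assume "\<not> ?thesis"
  then obtain h where h: "h \<in> I" "interior (closure (P i)) \<inter> interior (closure (P j)) \<inter> P h \<noteq> {}"
    using interior_meets_tile[OF open_Int[OF open_interior open_interior]] by metis
  then obtain p where p: "p \<in> closure (P i)" "p \<in> closure (P j)" "p \<in> P h"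
    using interior_subset by blast
  then have "i = h" "j = h" using separated assms h(1) by blast+
  with assms show False by simp
qed

lemma overlap_subset_frontier:
  assumes "i \<in> I" "j \<in> I" "i \<noteq> j"
  shows "closure (P i) \<inter> closure (P j) \<subseteq> frontier (closure (P i))"
proof
  fix p assume p: "p \<in> closure (P i) \<inter> closure (P j)"
  have "p \<notin> interior (closure (P i))"
  proof
    assume "p \<in> interior (closure (P i))"
    then have "interior (closure (P i)) \<inter> closure (interior (closure (P j))) \<noteq> {}"
      using p proper_closure_tile[OF assms(2)] by auto
    then show False
      using disjoint_interiors[OF assms] open_Int_closure_eq_empty[of "interior (closure (P i))"] by auto
  qed
  with p show "p \<in> frontier (closure (P i))" by (simp add: frontier_def)
qed

end

section \<open>The sawtooth series\<close>

text \<open>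
  The real numbers \<open>lam\<close> and \<open>m\<close> are the entries of the shear \<open>(x, y) \<mapsto> (lam x + m y, lam y)\<close>. Negative
  \<open>lam\<close> is included, which is why left and right limits are exchanged at some places below.
\<close>
locale shear_parameters =
  fixes lam m :: real
  assumes lam_Int: "lam \<in> \<int>" and l_ge2: "2 \<le> \<bar>lam\<bar>"
    and m_Int: "m \<in> \<int>" and m_nz: "m \<noteq> 0"
begin

abbreviation (input) l :: real where "l \<equiv> \<bar>lam\<bar>"

lemma lam_nz [simp]: "lam \<noteq> 0"
  using l_ge2 by auto

definition saw :: "real \<Rightarrow> real" where
  "saw y = - (m / lam) * (\<Sum>k. frac (lam ^ k * y) / lam ^ k)"

lemma saw_term_bound: "norm (frac (lam ^ k * y) / lam ^ k) \<le> (1/2) ^ k"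
proof -
  have "norm (frac (lam ^ k * y) / lam ^ k) = frac (lam ^ k * y) / l ^ k"
    by (simp add: power_abs)
  also have "\<dots> \<le> 1 / 2 ^ k"
    using l_ge2 by (intro frac_le power_mono) (auto intro: less_imp_le frac_lt_1)
  finally show ?thesis by (simp add: power_one_over)
qed

lemma saw_summable: "summable (\<lambda>k. frac (lam ^ k * y) / lam ^ k)"
  by (rule summable_comparison_test'[of "\<lambda>k. (1/2::real) ^ k" 0])
     (use saw_term_bound in auto)

lemma saw_bound: "\<bar>saw y\<bar> \<le> \<bar>m\<bar>"
proof -
  have "norm (\<Sum>k. frac (lam ^ k * y) / lam ^ k) \<le> (\<Sum>k. (1/2::real) ^ k)"
    by (rule norm_suminf_le) (use saw_term_bound in auto)
  also have "(\<Sum>k. (1/2::real) ^ k) = 2"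
    by (subst suminf_geometric) auto
  finally have *: "\<bar>\<Sum>k. frac (lam ^ k * y) / lam ^ k\<bar> \<le> 2" by simp
  have "\<bar>saw y\<bar> = \<bar>m\<bar> / l * \<bar>\<Sum>k. frac (lam ^ k * y) / lam ^ k\<bar>"
    by (simp add: saw_def abs_mult)
  also have "\<dots> \<le> \<bar>m\<bar> / 2 * 2"
    using l_ge2 * by (intro mult_mono frac_le) auto
  finally show ?thesis by simp
qed

text \<open>The equation that removes the shear, by splitting off the first term of the series.\<close>
lemma saw_lam: "saw (lam * y) = lam * saw y + m * frac y"
proof -
  let ?a = "\<lambda>k. frac (lam ^ k * y) / lam ^ k"
  have "(\<Sum>k. frac (lam ^ k * (lam * y)) / lam ^ k) = (\<Sum>k. lam * ?a (Suc k))"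
    by (intro suminf_cong) (simp add: ac_simps)
  also have "\<dots> = lam * (\<Sum>k. ?a (Suc k))"
    using saw_summable[of y] by (subst suminf_mult) (subst summable_Suc_iff, auto)
  also have "(\<Sum>k. ?a (Suc k)) = suminf ?a - frac y"
    using suminf_split_head[OF saw_summable[of y]] by simp
  finally have "(\<Sum>k. frac (lam ^ k * (lam * y)) / lam ^ k) = lam * (suminf ?a - frac y)" .
  then show ?thesis
    by (simp only: saw_def) (simp add: field_simps)
qed

lemma saw_periodic:
  assumes "z \<in> \<int>" shows "saw (y + z) = saw y"
proof -
  have "frac (lam ^ k * (y + z)) = frac (lam ^ k * y)" for k
  proof -
    have "lam ^ k * z \<in> \<int>" using assms lam_Int by (intro Ints_mult Ints_power)
    then show ?thesis by (simp add: distrib_left frac_add_int_right)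
  qed
  then show ?thesis by (simp add: saw_def)
qed

text \<open>
  Multiplication by \<open>lam\<close> maps an interval of level \<open>K + 1\<close> onto one of level \<open>K\<close>, and on it the
  functional equation expresses the series through its values at level \<open>K\<close>, divided by \<open>lam\<close>, and
  through \<open>frac\<close>, which is affine there. Each step thus adds only \<open>\<bar>m\<bar>\<close> to the numerator.
\<close>
lemma saw_oscillation:
  fixes q :: int
  assumes "q < l ^ K * y" "l ^ K * y < q + 1" "q < l ^ K * y'" "l ^ K * y' < q + 1"
  shows "\<bar>saw y - saw y'\<bar> \<le> (2 * \<bar>m\<bar> + K * \<bar>m\<bar>) / l ^ K"
  using assms
proof (induction K arbitrary: y y' q)
  case 0
  then show ?case using saw_bound[of y] saw_bound[of y'] by simp
next
  case (Suc K)
  have lpos: "l > 0" "l ^ K > 0" using l_ge2 by auto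
  \<comment> \<open>If \<open>lam\<close> is negative, the image of the open interval from \<open>q\<close> to \<open>q + 1\<close> is reflected.\<close>
  define s where "s = (if lam > 0 then q else - q - 1)"
  have strip: "s < l ^ K * (lam * t)" "l ^ K * (lam * t) < s + 1"
    if "q < l ^ Suc K * t" "l ^ Suc K * t < q + 1" for t
    using that by (auto simp: s_def abs_if ac_simps split: if_splits)
  have fl: "floor t = floor (q / l ^ Suc K)" if "q < l ^ Suc K * t" "l ^ Suc K * t < q + 1" for t
  proof (rule antisym)
    have "real_of_int q / l ^ Suc K < t" using that lpos by (simp add: field_simps)
    then show "floor (q / l ^ Suc K) \<le> floor t" by (intro floor_mono) simp
    have "real_of_int (floor t) * l ^ Suc K \<le> t * l ^ Suc K"
      using lpos by (intro mult_right_mono) auto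
    moreover obtain i :: int where i: "l ^ Suc K = i"
      using lam_Int by (metis Ints_abs Ints_cases Ints_power)
    ultimately have *: "real_of_int (floor t * i) < real_of_int (q + 1)"
      using that by (simp add: mult.commute del: power_Suc)
    have i_pos: "0 < real_of_int i" using lpos(1) by (simp only: i[symmetric] zero_less_power)
    from * have "floor t * i \<le> q" by linarith
    then have "real_of_int (floor t * i) \<le> q" by linarith
    then show "floor t \<le> floor (q / l ^ Suc K)"
      using i i_pos by (subst le_floor_iff) (simp add: field_simps)
  qed
  have fr: "\<bar>frac y - frac y'\<bar> \<le> 1 / l ^ Suc K"
  proof -
    have "frac y - frac y' = y - y'"
      using fl[of y] fl[of y'] Suc.prems by (simp add: frac_def)
    moreover have "\<bar>l ^ Suc K * y - l ^ Suc K * y'\<bar> \<le> 1" using Suc.prems by linarith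
    then have "\<bar>l ^ Suc K * (y - y')\<bar> \<le> 1" by (simp only: right_diff_distrib)
    then have "l ^ Suc K * \<bar>y - y'\<bar> \<le> 1" by (simp add: abs_mult)
    then have "\<bar>y - y'\<bar> \<le> 1 / l ^ Suc K"
      using lpos by (simp add: field_simps)
    ultimately show ?thesis by simp
  qed
  have "saw y - saw y' = ((saw (lam * y) - saw (lam * y')) - m * (frac y - frac y')) / lam"
    by (simp add: saw_lam field_simps)
  then have "\<bar>saw y - saw y'\<bar> = \<bar>(saw (lam * y) - saw (lam * y')) - m * (frac y - frac y')\<bar> / l"
    by simp
  also have "\<dots> \<le> ((2 * \<bar>m\<bar> + K * \<bar>m\<bar>) / l ^ K + \<bar>m\<bar> * (1 / l ^ Suc K)) / l"
  proof (intro divide_right_mono)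
    have "\<bar>saw (lam * y) - saw (lam * y')\<bar> \<le> (2 * \<bar>m\<bar> + K * \<bar>m\<bar>) / l ^ K"
      using Suc.prems by (intro Suc.IH[of s] strip)
    moreover have "\<bar>m * (frac y - frac y')\<bar> \<le> \<bar>m\<bar> * (1 / l ^ Suc K)"
      using fr unfolding abs_mult by (intro mult_left_mono) auto
    ultimately show "\<bar>(saw (lam * y) - saw (lam * y')) - m * (frac y - frac y')\<bar>
      \<le> (2 * \<bar>m\<bar> + K * \<bar>m\<bar>) / l ^ K + \<bar>m\<bar> * (1 / l ^ Suc K)" by linarith
  qed (use lpos in auto)
  also have "\<dots> = (2 * \<bar>m\<bar> + K * \<bar>m\<bar> + \<bar>m\<bar> / l) / l ^ Suc K"
    using lpos by (simp add: field_simps)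
  also have "\<dots> \<le> (2 * \<bar>m\<bar> + Suc K * \<bar>m\<bar>) / l ^ Suc K"
  proof (intro divide_right_mono)
    have "\<bar>m\<bar> / l \<le> \<bar>m\<bar> / 1" using l_ge2 by (intro divide_left_mono) auto
    then show "2 * \<bar>m\<bar> + K * \<bar>m\<bar> + \<bar>m\<bar> / l \<le> 2 * \<bar>m\<bar> + Suc K * \<bar>m\<bar>"
      by (simp add: algebra_simps)
  qed (use lpos in auto)
  finally show ?case .
qed

section \<open>Adic points, continuity and jumps\<close>

text \<open>
  The points at which some term of the series jumps. They form a countable set that is
  invariant under multiplication by \<open>lam\<close> in both directions.
\<close>
definition adic :: "real \<Rightarrow> bool" where
  "adic y \<longleftrightarrow> (\<exists>k. lam ^ k * y \<in> \<int>)"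

lemma adic_lam [simp]: "adic (lam * y) \<longleftrightarrow> adic y"
proof
  assume "adic (lam * y)"
  then obtain k where "lam ^ k * (lam * y) \<in> \<int>" unfolding adic_def by blast
  then have "lam ^ Suc k * y \<in> \<int>" by (simp add: ac_simps)
  then show "adic y" unfolding adic_def by blast
next
  assume "adic y"
  then obtain k where "lam ^ k * y \<in> \<int>" unfolding adic_def by blast
  then have "lam * (lam ^ k * y) \<in> \<int>" using lam_Int by (rule Ints_mult[rotated])
  then show "adic (lam * y)" unfolding adic_def by (intro exI[of _ k]) (simp add: ac_simps)
qed

lemma adic_add_Int [simp]:
  assumes "z \<in> \<int>" shows "adic (y + z) \<longleftrightarrow> adic y"
proof -
  have "lam ^ k * (y + z) \<in> \<int> \<longleftrightarrow> lam ^ k * y \<in> \<int>" for k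
  proof -
    have "lam ^ k * z \<in> \<int>" using assms lam_Int by (intro Ints_mult Ints_power)
    then show ?thesis by (metis Ints_add Ints_diff add_diff_cancel_right' distrib_left)
  qed
  then show ?thesis by (simp add: adic_def)
qed

lemma not_adic_scaled: "\<not> adic y \<Longrightarrow> l ^ n * y \<notin> \<int>"
proof
  assume "\<not> adic y" "l ^ n * y \<in> \<int>"
  moreover have "l ^ n * y = lam ^ n * y \<or> l ^ n * y = - (lam ^ n * y)"
    by (metis abs_mult_pos abs_if minus_mult_left power_abs)
  ultimately show False unfolding adic_def by (metis Ints_minus add.inverse_inverse)
qed

lemma countable_adic: "countable {y. adic y}"
proof -
  have "{y. adic y} \<subseteq> (\<Union>k. (\<lambda>z. z / lam ^ k) ` \<int>)"
  proof
    fix y assume "y \<in> {y. adic y}"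
    then obtain k where "lam ^ k * y \<in> \<int>" unfolding adic_def by blast
    then have "y \<in> (\<lambda>z. z / lam ^ k) ` \<int>"
      by (intro image_eqI[of _ _ "lam ^ k * y"]) auto
    then show "y \<in> (\<Union>k. (\<lambda>z. z / lam ^ k) ` \<int>)" by blast
  qed
  moreover have "countable (\<int> :: real set)" unfolding Ints_def by simp
  ultimately show ?thesis by (meson countable_UN countable_image countable_subset countableI_type)
qed

lemma nonadic_between:
  assumes "a < b" obtains y where "a < y" "y < b" "\<not> adic y"
proof -
  have "\<not> {a<..<b} \<subseteq> {y. adic y}"
    using uncountable_open_interval[of a b] assms countable_adic countable_subset by blast
  then obtain y where "y \<in> {a<..<b}" "\<not> adic y" by blast
  then show ?thesis using that[of y] by simp
qed

lemma linear_over_power_tendsto_0: "(\<lambda>K. (a + real K * b) / l ^ K) \<longlonglongrightarrow> 0"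
proof -
  have *: "norm (1 / l) < 1" using l_ge2 by simp
  have "(\<lambda>K. a * (1 / l) ^ K + b * (real K * (1 / l) ^ K)) \<longlonglongrightarrow> a * 0 + b * 0"
    using * by (intro tendsto_intros LIMSEQ_power_zero powser_times_n_limit_0)
  then show ?thesis by (simp add: field_simps power_one_over)
qed

text \<open>
  Near \<open>0\<close> the functional equation determines the two limits: as \<open>frac t\<close> tends to \<open>0\<close> from the right
  and to \<open>1\<close> from the left, they satisfy \<open>p = lam p\<close> and \<open>q = lam q + m\<close> if \<open>lam\<close> is positive, and
  \<open>q = lam p\<close> and \<open>p = lam q + m\<close> if \<open>lam\<close> is negative. The numbers \<open>p\<close> and \<open>q\<close> in the proof are the
  solutions. When \<open>t\<close> is replaced by \<open>t/lam\<close>, the deviation from them is divided by \<open>lam\<close>, up to an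
  error proportional to \<open>t\<close>.
\<close>
lemma saw_limits_0:
  "\<exists>p q. (saw \<longlongrightarrow> p) (at_right 0) \<and> (saw \<longlongrightarrow> q) (at_left 0) \<and> \<bar>p - q\<bar> = \<bar>m\<bar> / (l - 1)"
proof -
  define p where "p = (if lam > 0 then 0 else m / (1 - lam ^ 2))"
  define q where "q = (if lam > 0 then - m / (lam - 1) else lam * m / (1 - lam ^ 2))"
  define G where "G t = (if t > 0 then p else q)" for t :: real
  define B where "B = \<bar>m\<bar> + \<bar>p\<bar> + \<bar>q\<bar>"
  have sq: "1 - lam ^ 2 = (1 - lam) * (1 + lam)" by (simp add: power2_eq_square algebra_simps)
  have pq: "lam > 0 \<Longrightarrow> lam * p = p \<and> lam * q + m = q" "lam < 0 \<Longrightarrow> lam * p = q \<and> lam * q + m = p"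
  proof -
    show "lam > 0 \<Longrightarrow> lam * p = p \<and> lam * q + m = q"
      using l_ge2 by (simp add: p_def q_def field_simps)
    assume "lam < 0"
    with l_ge2 have "1 - lam ^ 2 \<noteq> 0" by (auto simp: sq)
    with \<open>lam < 0\<close> show "lam * p = q \<and> lam * q + m = p"
      by (simp add: p_def q_def divide_simps) (simp add: power2_eq_square algebra_simps)
  qed
  have G_lam: "G (lam * t) = lam * G t + m * (frac t - t)" if "t \<noteq> 0" "\<bar>t\<bar> < 1" for t
  proof (cases "t > 0")
    case True
    then have "frac t = t" using that by (simp add: frac_eq)
    then show ?thesis using True pq l_ge2
      by (cases "lam > 0") (auto simp: G_def zero_less_mult_iff)
  next
    case False
    then have "frac t = t + 1" using that by (subst frac_unique_iff) auto
    then show ?thesis using False that pq l_ge2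
      by (cases "lam > 0") (auto simp: G_def zero_less_mult_iff)
  qed
  have dev: "\<bar>saw t - G t\<bar> \<le> (B + K * \<bar>m\<bar>) / l ^ K" if "t \<noteq> 0" "l ^ K * \<bar>t\<bar> < 1" for t K
    using that
  proof (induction K arbitrary: t)
    case 0
    show ?case using saw_bound[of t] by (auto simp: G_def B_def)
  next
    case (Suc K)
    have lpos: "l > 0" "l ^ K > 0" using l_ge2 by auto
    have "1 \<le> l ^ Suc K" using l_ge2 by (intro one_le_power) simp
    then have "1 * \<bar>t\<bar> \<le> l ^ Suc K * \<bar>t\<bar>" by (intro mult_right_mono) auto
    then have t1: "\<bar>t\<bar> < 1" using Suc.prems by linarith
    have tK: "\<bar>t\<bar> \<le> 1 / l ^ Suc K"
      using Suc.prems lpos by (simp add: field_simps)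
    have "saw t - G t = ((saw (lam * t) - G (lam * t)) - m * t) / lam"
      using G_lam[OF Suc.prems(1) t1] by (simp add: saw_lam field_simps)
    then have "\<bar>saw t - G t\<bar> = \<bar>(saw (lam * t) - G (lam * t)) - m * t\<bar> / l" by simp
    also have "\<dots> \<le> ((B + K * \<bar>m\<bar>) / l ^ K + \<bar>m\<bar> * (1 / l ^ Suc K)) / l"
    proof (intro divide_right_mono)
      have "\<bar>saw (lam * t) - G (lam * t)\<bar> \<le> (B + K * \<bar>m\<bar>) / l ^ K"
        using Suc.prems by (intro Suc.IH) (auto simp: abs_mult ac_simps)
      moreover have "\<bar>m * t\<bar> \<le> \<bar>m\<bar> * (1 / l ^ Suc K)"
        using tK unfolding abs_mult by (intro mult_left_mono) auto
      ultimately show "\<bar>(saw (lam * t) - G (lam * t)) - m * t\<bar>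
        \<le> (B + K * \<bar>m\<bar>) / l ^ K + \<bar>m\<bar> * (1 / l ^ Suc K)" by linarith
    qed (use lpos in auto)
    also have "\<dots> = (B + K * \<bar>m\<bar> + \<bar>m\<bar> / l) / l ^ Suc K"
      using lpos by (simp add: field_simps)
    also have "\<dots> \<le> (B + Suc K * \<bar>m\<bar>) / l ^ Suc K"
    proof (intro divide_right_mono)
      have "\<bar>m\<bar> / l \<le> \<bar>m\<bar> / 1" using l_ge2 by (intro divide_left_mono) auto
      then show "B + K * \<bar>m\<bar> + \<bar>m\<bar> / l \<le> B + Suc K * \<bar>m\<bar>"
        by (simp add: algebra_simps)
    qed (use lpos in auto)
    finally show ?case .
  qed
  have lim: "(saw \<longlongrightarrow> c) (at 0 within S)" if "\<And>t. t \<in> S \<Longrightarrow> t \<noteq> 0 \<Longrightarrow> G t = c" for S c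
  proof (rule tendstoI)
    fix e :: real assume "e > 0"
    then have "eventually (\<lambda>K. (B + real K * \<bar>m\<bar>) / l ^ K < e) sequentially"
      by (intro order_tendstoD(2)[OF linear_over_power_tendsto_0])
    then obtain K where K: "(B + real K * \<bar>m\<bar>) / l ^ K < e"
      by (meson eventually_happens' sequentially_bot)
    show "\<forall>\<^sub>F t in at 0 within S. dist (saw t) c < e"
      unfolding eventually_at
    proof (intro exI[of _ "1 / l ^ K"] conjI ballI impI)
      show "1 / l ^ K > 0" using l_ge2 by simp
      fix t assume t: "t \<in> S" "t \<noteq> 0 \<and> dist t 0 < 1 / l ^ K"
      moreover have "l ^ K > 0" using l_ge2 by simp
      ultimately have "l ^ K * \<bar>t\<bar> < 1" by (simp add: field_simps)
      from dev[OF _ this] t K that show "dist (saw t) c < e" by (auto simp: dist_real_def)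
    qed
  qed
  have "(saw \<longlongrightarrow> p) (at_right 0)" "(saw \<longlongrightarrow> q) (at_left 0)"
    by (intro lim; simp add: G_def)+
  moreover have "\<bar>p - q\<bar> = \<bar>m\<bar> / (l - 1)"
  proof (cases "lam > 0")
    case True
    then show ?thesis using l_ge2 by (simp add: p_def q_def)
  next
    case False
    then have n: "lam < 0" using l_ge2 by linarith
    then have "(lam + 1) * (p - q) = m"
      using pq(2)[OF n] by (simp only: distrib_right distrib_left right_diff_distrib) linarith
    then have "\<bar>lam + 1\<bar> * \<bar>p - q\<bar> = \<bar>m\<bar>" by (metis abs_mult)
    moreover have "\<bar>lam + 1\<bar> = l - 1" "l - 1 > 0" using n l_ge2 by auto
    ultimately show ?thesis by (simp add: field_simps)
  qed
  ultimately show ?thesis by blast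
qed

text \<open>
  Away from the integers \<open>frac\<close> is continuous, so the functional equation carries one-sided limits
  from \<open>lam y\<close> back to \<open>y\<close>.
\<close>
lemma saw_tendsto_pullback:
  assumes "y \<notin> \<int>" "(saw \<longlongrightarrow> a) (at (lam * y) within T)" "\<And>t. t \<in> S \<Longrightarrow> lam * t \<in> T"
  shows "(saw \<longlongrightarrow> (a - m * frac y) / lam) (at y within S)"
proof -
  have "filterlim (\<lambda>t. lam * t) (at (lam * y) within T) (at y within S)"
    unfolding filterlim_at
  proof
    show "\<forall>\<^sub>F t in at y within S. lam * t \<in> T \<and> lam * t \<noteq> lam * y"
      using assms(3) by (auto simp: eventually_at intro!: exI[of _ 1])
  qed (intro tendsto_intros)
  then have "((\<lambda>t. saw (lam * t)) \<longlongrightarrow> a) (at y within S)"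
    using assms(2) by (rule filterlim_compose[rotated])
  moreover have "((\<lambda>t. frac t) \<longlongrightarrow> frac y) (at y within S)"
    using continuous_frac[OF assms(1)] by (auto simp: continuous_at intro: tendsto_within_subset)
  ultimately have "((\<lambda>t. (saw (lam * t) - m * frac t) / lam) \<longlongrightarrow> (a - m * frac y) / lam) (at y within S)"
    by (intro tendsto_intros) auto
  then show ?thesis by (simp add: saw_lam)
qed

text \<open>
  The jump at the integers, pulled back \<open>k\<close> times: each step divides it by \<open>lam\<close>.
\<close>
lemma saw_jump:
  assumes "lam ^ k * y \<in> \<int>" "\<And>i. i < k \<Longrightarrow> lam ^ i * y \<notin> \<int>"
  shows "\<exists>a b. (saw \<longlongrightarrow> a) (at_right y) \<and> (saw \<longlongrightarrow> b) (at_left y) \<and>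
    \<bar>a - b\<bar> = \<bar>m\<bar> / (l - 1) / l ^ k"
  using assms
proof (induction k arbitrary: y)
  case 0
  then have y: "y \<in> \<int>" by simp
  have shift: "(saw \<longlongrightarrow> c) (at y within S)" if "(saw \<longlongrightarrow> c) (at 0 within T)" "\<And>t. t \<in> S \<Longrightarrow> t - y \<in> T" for c S T
  proof -
    have "filterlim (\<lambda>t. t - y) (at 0 within T) (at y within S)"
      unfolding filterlim_at
    proof
      show "\<forall>\<^sub>F t in at y within S. t - y \<in> T \<and> t - y \<noteq> 0"
        using that(2) by (auto simp: eventually_at intro!: exI[of _ 1])
      have "((\<lambda>t. t - y) \<longlongrightarrow> y - y) (at y within S)" by (intro tendsto_intros)
      then show "((\<lambda>t. t - y) \<longlongrightarrow> 0) (at y within S)" by simp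
    qed
    then have "((\<lambda>t. saw (t - y)) \<longlongrightarrow> c) (at y within S)"
      using that(1) by (rule filterlim_compose[rotated])
    moreover have "saw (t - y) = saw t" for t
      using saw_periodic[OF y, of "t - y"] by (metis diff_add_cancel)
    ultimately show ?thesis by simp
  qed
  obtain p q where pq: "(saw \<longlongrightarrow> p) (at_right 0)" "(saw \<longlongrightarrow> q) (at_left 0)" "\<bar>p - q\<bar> = \<bar>m\<bar> / (l - 1)"
    using saw_limits_0 by blast
  show ?case
    by (intro exI[of _ p] exI[of _ q] conjI shift[OF pq(1)] shift[OF pq(2)]) (use pq in auto)
next
  case (Suc k)
  have y: "y \<notin> \<int>" using Suc.prems(2)[of 0] by simp
  have "\<exists>a b. (saw \<longlongrightarrow> a) (at_right (lam * y)) \<and> (saw \<longlongrightarrow> b) (at_left (lam * y)) \<and>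
    \<bar>a - b\<bar> = \<bar>m\<bar> / (l - 1) / l ^ k"
  proof (rule Suc.IH)
    show "lam ^ k * (lam * y) \<in> \<int>" using Suc.prems(1) by (simp add: ac_simps)
    show "lam ^ i * (lam * y) \<notin> \<int>" if "i < k" for i
      using Suc.prems(2)[of "Suc i"] that by (simp add: ac_simps)
  qed
  then obtain a b where ab: "(saw \<longlongrightarrow> a) (at_right (lam * y))" "(saw \<longlongrightarrow> b) (at_left (lam * y))"
    "\<bar>a - b\<bar> = \<bar>m\<bar> / (l - 1) / l ^ k" by blast
  have jump: "\<bar>(a - m * frac y) / lam - (b - m * frac y) / lam\<bar> = \<bar>m\<bar> / (l - 1) / l ^ Suc k"
    using ab(3) by (simp add: diff_divide_distrib[symmetric])
  note ab' = saw_tendsto_pullback[OF y ab(1)] saw_tendsto_pullback[OF y ab(2)]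
  show ?case
  proof (cases "lam > 0")
    case True
    have "(saw \<longlongrightarrow> (a - m * frac y) / lam) (at_right y)"
      by (rule ab') (use True in auto)
    moreover have "(saw \<longlongrightarrow> (b - m * frac y) / lam) (at_left y)"
      by (rule ab') (use True in auto)
    ultimately show ?thesis using jump by blast
  next
    case False
    then have "lam < 0" using l_ge2 by linarith
    then have "(saw \<longlongrightarrow> (a - m * frac y) / lam) (at_left y)"
      by (intro ab') auto
    moreover have "(saw \<longlongrightarrow> (b - m * frac y) / lam) (at_right y)"
      by (rule ab') (use \<open>lam < 0\<close> in auto)
    ultimately show ?thesis using jump by (metis abs_minus_commute)
  qed
qed

lemma saw_continuous:
  assumes "\<not> adic y" shows "isCont saw y"
  unfolding continuous_at_eps_delta
proof (intro allI impI)
  fix e :: real assume "e > 0"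
  then have "eventually (\<lambda>K. (2 * \<bar>m\<bar> + real K * \<bar>m\<bar>) / l ^ K < e) sequentially"
    by (intro order_tendstoD(2)[OF linear_over_power_tendsto_0])
  then obtain K where K: "(2 * \<bar>m\<bar> + real K * \<bar>m\<bar>) / l ^ K < e"
    by (meson eventually_happens' sequentially_bot)
  define q where "q = floor (l ^ K * y)"
  have ni: "l ^ K * y \<notin> \<int>" using assms by (rule not_adic_scaled)
  then have "l ^ K * y \<noteq> q" by (metis Ints_of_int)
  then have q: "q < l ^ K * y" "l ^ K * y < q + 1"
    unfolding q_def using floor_correct[of "l ^ K * y"] by linarith+
  have lK: "l ^ K > 0" using l_ge2 by simp
  define d where "d = min (y - q / l ^ K) ((q + 1) / l ^ K - y)"
  have d: "d > 0" using q lK by (simp add: d_def field_simps)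
  have "dist (saw y') (saw y) < e" if "dist y' y < d" for y'
  proof -
    have "y' > q / l ^ K" "y' < (q + 1) / l ^ K" using that unfolding d_def dist_real_def by linarith+
    then have "q < l ^ K * y'" "l ^ K * y' < q + 1" using lK by (simp_all add: field_simps)
    from saw_oscillation[OF this q] K show ?thesis by (simp add: dist_real_def)
  qed
  with d show "\<exists>d>0. \<forall>y'. dist y' y < d \<longrightarrow> dist (saw y') (saw y) < e" by blast
qed

lemma saw_one_sided_limits:
  "\<exists>a b. (saw \<longlongrightarrow> a) (at_right y) \<and> (saw \<longlongrightarrow> b) (at_left y)"
proof (cases "adic y")
  case True
  define k where "k = (LEAST k. lam ^ k * y \<in> \<int>)"
  have "lam ^ k * y \<in> \<int>" using True unfolding adic_def k_def by (rule LeastI_ex)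
  moreover have "lam ^ i * y \<notin> \<int>" if "i < k" for i using that not_less_Least unfolding k_def by blast
  ultimately show ?thesis using saw_jump[of k y] by blast
next
  case False
  then have "(saw \<longlongrightarrow> saw y) (at y within S)" for S
    using saw_continuous by (auto simp: continuous_at intro: tendsto_within_subset[of _ _ _ UNIV])
  then show ?thesis by blast
qed

text \<open>
  The expansivity argument on the circle: as long as \<open>lam^k d\<close> is within \<open>e\<close> of \<open>0\<close>, the next
  multiple has size at most \<open>l e\<close>, so an integer within \<open>e\<close> of it can only be \<open>0\<close>. Hence all the
  multiples stay bounded.
\<close>
lemma expanding_near_Ints_eq_0:
  assumes "(l + 1) * e < 1" "\<bar>d\<bar> \<le> e" "\<And>k. \<exists>z\<in>\<int>. \<bar>lam ^ k * d - z\<bar> \<le> e"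
  shows "d = 0"
proof (rule ccontr)
  assume d: "d \<noteq> 0"
  have le: "l ^ k * \<bar>d\<bar> \<le> e" for k
  proof (induction k)
    case 0 then show ?case using assms(2) by simp
  next
    case (Suc k)
    obtain z where z: "z \<in> \<int>" "\<bar>lam ^ Suc k * d - z\<bar> \<le> e" using assms(3) by blast
    have eq: "l ^ Suc k * \<bar>d\<bar> = \<bar>lam ^ Suc k * d\<bar>" by (simp add: abs_mult power_abs)
    have "l * (l ^ k * \<bar>d\<bar>) \<le> l * e" using Suc by (intro mult_left_mono) auto
    then have "\<bar>lam ^ Suc k * d\<bar> \<le> l * e" unfolding eq[symmetric] by (simp add: ac_simps)
    then have "\<bar>z\<bar> < 1" using z assms(1) by (simp add: distrib_right)
    then have "z = 0" using z(1) Ints_nonzero_abs_less1 by blast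
    then show ?case using z(2) unfolding eq by simp
  qed
  obtain k where "e / \<bar>d\<bar> < l ^ k" using real_arch_pow[of l "e / \<bar>d\<bar>"] l_ge2 by auto
  then show False using le[of k] d by (simp add: field_simps)
qed

lemma fine_scale_exists: "\<exists>n. 1 \<le> n \<and> 4 * l * ((1 + 2 * \<bar>m\<bar> + real n * \<bar>m\<bar>) / l ^ n) \<le> 1"
proof -
  define w where "w n = ((1 + 2 * \<bar>m\<bar>) + real n * \<bar>m\<bar>) / l ^ n" for n
  have "(\<lambda>n. 4 * l * w n) \<longlonglongrightarrow> 4 * l * 0"
    unfolding w_def by (intro tendsto_mult_left linear_over_power_tendsto_0)
  then have "eventually (\<lambda>n. 4 * l * w n < 1) sequentially"
    by (rule order_tendstoD(2)) simp
  from eventually_conj[OF this eventually_ge_at_top[of 1]]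
  obtain n where n: "4 * l * w n < 1" "1 \<le> n"
    by (auto simp: eventually_sequentially)
  have "4 * l * w n \<le> 1" using n(1) by (rule less_imp_le)
  then show ?thesis using n(2) unfolding w_def by blast
qed

lemma eventually_at_side_nonadic:
  assumes "S = {y<..} \<or> S = {..<y}" "eventually Q (at y within S)"
  obtains t where "t \<in> S" "\<not> adic t" "Q t"
  using assms(1)
proof
  assume S: "S = {y<..}"
  with assms(2) obtain b where b: "b > y" "\<And>t. y < t \<Longrightarrow> t < b \<Longrightarrow> Q t"
    by (auto simp: eventually_at_right_field)
  with nonadic_between[OF b(1)] show thesis using that S by (metis greaterThan_iff)
next
  assume S: "S = {..<y}"
  with assms(2) obtain b where b: "b < y" "\<And>t. b < t \<Longrightarrow> t < y \<Longrightarrow> Q t"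
    by (auto simp: eventually_at_left_field)
  with nonadic_between[OF b(1)] show thesis using that S by (metis lessThan_iff)
qed

text \<open>
  A point is approached from one side of its height by points whose straightened first coordinate
  is as close as desired to \<open>x - a\<close>, where \<open>a\<close> is the limit of the series from that side. The
  straightened coordinate can at the same time be kept inside any open interval whose closure
  contains \<open>x - a\<close>.
\<close>
lemma in_closure_of_strip:
  assumes S: "S = {y<..} \<or> S = {..<y}" and lim: "(saw \<longlongrightarrow> a) (at y within S)"
    and ev: "eventually Q (at y within S)"
    and s: "s1 \<le> x - a" "x - a \<le> s2" "s1 < s2"
  shows "(x, y) \<in> closure {(x', y'). \<not> adic y' \<and> Q y' \<and> \<not> adic (x' - saw y') \<and>
    s1 < x' - saw y' \<and> x' - saw y' < s2}" (is "_ \<in> closure ?S")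
  unfolding closure_approachable
proof (intro allI impI)
  fix e :: real assume e: "e > 0"
  have "eventually (\<lambda>t. dist (saw t) a < e / 4) (at y within S)"
    using lim e by (intro tendstoD) auto
  moreover have "eventually (\<lambda>t. dist t y < e / 4) (at y within S)"
    using e by (intro tendstoD tendsto_ident_at) auto
  ultimately have "eventually (\<lambda>t. Q t \<and> dist (saw t) a < e / 4 \<and> dist t y < e / 4) (at y within S)"
    using ev by eventually_elim auto
  then obtain t where t: "t \<in> S" "\<not> adic t" "Q t" "\<bar>saw t - a\<bar> < e / 4" "\<bar>t - y\<bar> < e / 4"
    using eventually_at_side_nonadic[OF S] by (metis (no_types, lifting) dist_real_def)
  have "max s1 (x - a - e / 4) < min s2 (x - a + e / 4)" using s e by auto
  then obtain z where z: "max s1 (x - a - e / 4) < z" "z < min s2 (x - a + e / 4)" "\<not> adic z"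
    by (rule nonadic_between)
  have "norm ((z + saw t, t) - (x, y)) \<le> norm (z + saw t - x) + norm (t - y)"
    by (metis diff_Pair norm_Pair_le)
  also have "\<dots> < e"
  proof -
    have "x - a - e / 4 < z" "z < x - a + e / 4" using z by auto
    then show ?thesis using t(4,5) e unfolding real_norm_def by linarith
  qed
  finally have "dist (z + saw t, t) (x, y) < e" by (simp add: dist_norm)
  moreover have "(z + saw t, t) \<in> ?S" using z t by auto
  ultimately show "\<exists>p\<in>?S. dist p (x, y) < e" by blast
qed

end

section \<open>Tiles of a sheared endomorphism\<close>

text \<open>
  The map \<open>proj\<close> is the covering of the torus by the plane in the coordinates of an integer basis, and
  \<open>n\<close> is the level of the partition. The condition \<open>fine\<close> bounds the sum of the width \<open>l\<^sup>-\<^sup>n\<close> of a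
  square and of the oscillation of the series on an interval of this length.
\<close>
locale sheared_endomorphism = shear_parameters +
  fixes proj :: "real \<times> real \<Rightarrow> 'a::metric_space" and f :: "'a \<Rightarrow> 'a" and c :: real and n :: nat
  assumes proj_cont: "continuous_on UNIV proj"
    and proj_open: "open S \<Longrightarrow> open (proj ` S)"
    and proj_surj: "range proj = UNIV"
    and proj_eq: "proj (x, y) = proj (x', y') \<longleftrightarrow> x - x' \<in> \<int> \<and> y - y' \<in> \<int>"
    and f_proj: "f (proj (x, y)) = proj (lam * x + m * y, lam * y)"
    and c_pos: "0 < c"
    and proj_dist: "\<exists>a\<in>\<int>. \<exists>b\<in>\<int>. c * max \<bar>x - x' - a\<bar> \<bar>y - y' - b\<bar> \<le> dist (proj (x, y)) (proj (x', y'))"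
    and n_pos: "1 \<le> n"
    and fine: "4 * l * ((1 + 2 * \<bar>m\<bar> + real n * \<bar>m\<bar>) / l ^ n) \<le> 1"
begin

definition L :: int where "L = \<lfloor>l ^ n\<rfloor>"

lemma of_L: "of_int L = l ^ n"
  unfolding L_def using lam_Int by (metis Ints_abs Ints_cases Ints_power floor_of_int)

lemma L_ge2: "2 \<le> L"
proof -
  have "l ^ 1 \<le> l ^ n" using l_ge2 n_pos by (intro power_increasing) auto
  then have "2 \<le> real_of_int L" unfolding of_L using l_ge2 by simp
  then show ?thesis by simp
qed

definition cell :: "real \<Rightarrow> int" where "cell t = \<lfloor>of_int L * t\<rfloor> mod L"

lemma cell_add_Int: "z \<in> \<int> \<Longrightarrow> cell (t + z) = cell t"
proof -
  assume "z \<in> \<int>"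
  then obtain i :: int where i: "z = i" by (auto elim: Ints_cases)
  have "L * (t + z) = L * t + of_int (L * i)" by (simp add: i distrib_left)
  then have "\<lfloor>L * (t + z)\<rfloor> = \<lfloor>L * t\<rfloor> + L * i" by (metis floor_add_int)
  then show ?thesis by (simp add: cell_def)
qed

lemma cell_in_range: "cell t \<in> {0..<L}"
  using L_ge2 by (simp add: cell_def)

lemma cell_eqI: "of_int q < of_int L * t \<Longrightarrow> of_int L * t < of_int q + 1 \<Longrightarrow> cell t = q mod L"
  unfolding cell_def by (subst floor_unique[of q]) auto

lemma nonadic_in_strip:
  fixes t :: real assumes "\<not> adic t" shows "\<lfloor>L * t\<rfloor> < L * t" "L * t < \<lfloor>L * t\<rfloor> + 1"
proof -
  have "L * t \<notin> \<int>" unfolding of_L using assms by (rule not_adic_scaled)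
  then have "L * t \<noteq> \<lfloor>L * t\<rfloor>" by (metis Ints_of_int)
  then show "\<lfloor>L * t\<rfloor> < of_int L * t" "L * t < \<lfloor>L * t\<rfloor> + 1" using floor_correct[of "L * t"] by linarith+
qed

text \<open>
  The Markov property of multiplication by \<open>lam\<close> on the circle. The endpoints of the cells are the
  fractions with denominator \<open>L\<close>, which multiplication by the integer \<open>lam\<close> maps to each other. So
  once \<open>s\<close> is translated into the interval of length \<open>1/L\<close> that contains \<open>lam * t\<close>, no endpoint
  separates its quotient by \<open>lam\<close> from \<open>t\<close>.
\<close>
lemma cell_pullback:
  assumes "\<not> adic t" "\<not> adic s" "cell s = cell (lam * t)"
  obtains t' where "\<not> adic t'" "cell t' = cell t" "lam * t' - s \<in> \<int>"
proof -
  define q where "q = \<lfloor>L * (lam * t)\<rfloor>"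
  define r where "r = \<lfloor>L * s\<rfloor>"
  have "r mod L = q mod L" using assms(3) by (simp add: cell_def q_def r_def)
  then obtain i where i: "q = r + L * i" by (metis mod_eqE)
  define t' where "t' = (s + i) / lam"
  have lt': "lam * t' = s + i" by (simp add: t'_def)
  then have nonadic: "\<not> adic t'" using assms(2) adic_lam[of t'] by simp
  have s: "q < lam * (L * t')" "lam * (L * t') < q + 1"
  proof -
    have "lam * (L * t') = of_int L * s + of_int L * of_int i" using arg_cong[OF lt', of "\<lambda>z. L * z"] by (simp add: algebra_simps)
    then show "q < lam * (L * t')" "lam * (L * t') < q + 1"
      using nonadic_in_strip[OF assms(2)] unfolding r_def[symmetric] i by simp_all
  qed
  have "\<not> adic (lam * t)" using assms(1) by simp
  from nonadic_in_strip[OF this] have t: "q < lam * (L * t)" "lam * (L * t) < q + 1"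
    unfolding q_def[symmetric] by (simp_all add: mult.left_commute)
  have "\<lfloor>L * t'\<rfloor> = \<lfloor>L * t\<rfloor>"
  proof (rule ccontr)
    obtain il :: int where il: "lam = il" using lam_Int by (auto elim: Ints_cases)
    \<comment> \<open>An endpoint \<open>j / L\<close> between the two points would be mapped to an endpoint strictly inside a cell.\<close>
    have no_int: False if "of_int L * u \<le> of_int j" "of_int j \<le> of_int L * v" "{u, v} = {t, t'}" for u v :: real and j :: int
    proof -
      have b: "q < lam * (L * u)" "lam * (L * u) < q + 1" "q < lam * (L * v)" "lam * (L * v) < q + 1"
        using that s t by (auto simp: doubleton_eq_iff)
      have "q < lam * j \<and> lam * j < q + 1"
      proof (cases "lam > 0")
        case True
        then have "lam * (L * u) \<le> lam * j" "lam * j \<le> lam * (L * v)" using that by simp_all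
        then show ?thesis using b by linarith
      next
        case False
        then have "lam * (L * u) \<ge> lam * j" "lam * j \<ge> lam * (L * v)" using that
          by (simp_all add: mult_left_mono_neg)
        then show ?thesis using b by linarith
      qed
      then have "real_of_int q < real_of_int (il * j) \<and> real_of_int (il * j) < real_of_int (q + 1)" by (simp add: il)
      then have "q < il * j \<and> il * j < q + 1" by (simp only: of_int_less_iff)
      then show False by linarith
    qed
    assume "\<lfloor>L * t'\<rfloor> \<noteq> \<lfloor>L * t\<rfloor>"
    then consider "\<lfloor>L * t'\<rfloor> < \<lfloor>L * t\<rfloor>" | "\<lfloor>L * t\<rfloor> < \<lfloor>L * t'\<rfloor>" by linarith
    then show False
    proof cases
      case 1
      then have "L * t' \<le> \<lfloor>L * t\<rfloor>" "\<lfloor>L * t\<rfloor> \<le> L * t" by linarith+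
      then show False by (rule no_int) auto
    next
      case 2
      then have "L * t \<le> \<lfloor>L * t'\<rfloor>" "\<lfloor>L * t'\<rfloor> \<le> L * t'" by linarith+
      then show False by (rule no_int) auto
    qed
  qed
  then have "cell t' = cell t" by (simp add: cell_def)
  then show ?thesis using nonadic lt' by (intro that[of t']) auto
qed

definition generic :: "real \<Rightarrow> real \<Rightarrow> bool" where
  "generic x y \<longleftrightarrow> \<not> adic y \<and> \<not> adic (x - saw y)"

definition address :: "real \<Rightarrow> real \<Rightarrow> int \<times> int" where
  "address x y = (cell (x - saw y), cell y)"

definition addresses :: "(int \<times> int) set" where
  "addresses = {0..<L} \<times> {0..<L}"

definition tile :: "int \<times> int \<Rightarrow> 'a set" where
  "tile a = {proj (x, y) | x y. generic x y \<and> address x y = a}"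

lemma address_in [simp]: "address x y \<in> addresses"
  using cell_in_range by (simp add: address_def addresses_def)

lemma generic_address_proj:
  assumes "proj (x, y) = proj (x', y')"
  shows "generic x y = generic x' y'" "address x y = address x' y'"
proof -
  have xy: "x - x' \<in> \<int>" "y - y' \<in> \<int>" using assms by (auto simp: proj_eq)
  have "saw y = saw y'" using saw_periodic[OF xy(2), of y'] by simp
  moreover have "adic y = adic y'" "cell y = cell y'"
    using adic_add_Int[OF xy(2), of y'] cell_add_Int[OF xy(2), of y'] by simp_all
  moreover have "adic (x - saw y') = adic (x' - saw y')" "cell (x - saw y') = cell (x' - saw y')"
    using adic_add_Int[OF xy(1), of "x' - saw y'"] cell_add_Int[OF xy(1), of "x' - saw y'"] by simp_all
  ultimately show "generic x y = generic x' y'" "address x y = address x' y'"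
    by (simp_all add: generic_def address_def)
qed

lemma proj_in_tile: "proj (x, y) \<in> tile a \<longleftrightarrow> generic x y \<and> address x y = a"
  unfolding tile_def using generic_address_proj by blast

text \<open>
  In the coordinate \<open>x - saw y\<close> the shear becomes multiplication by \<open>lam\<close>, up to the integer
  \<open>m * floor y\<close>.
\<close>
lemma straighten: "lam * x + m * y - saw (lam * y) = lam * (x - saw y) + m * \<lfloor>y\<rfloor>"
  by (simp add: saw_lam frac_def algebra_simps)

lemma generic_image:
  assumes "generic x y"
  shows "generic (lam * x + m * y) (lam * y)"
    and "address (lam * x + m * y) (lam * y) = (cell (lam * (x - saw y)), cell (lam * y))"
  using assms m_Int unfolding generic_def address_def straighten
  by (simp_all add: cell_add_Int)

lemma proj_closure:
  assumes "(x, y) \<in> closure S" "proj ` S \<subseteq> T" shows "proj (x, y) \<in> closure T"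
proof -
  have "proj ` closure S \<subseteq> closure T"
    using assms(2) closure_subset[of T] continuous_on_subset[OF proj_cont]
    by (intro image_closure_subset) auto
  then show ?thesis using assms(1) by blast
qed

text \<open>
  One-sided limits exist at every height, so every point is approached by generic points from
  above.
\<close>
lemma dense_tiles: "closure (\<Union>a\<in>addresses. tile a) = UNIV"
proof -
  have "proj (x, y) \<in> closure (\<Union>a\<in>addresses. tile a)" for x y
  proof -
    obtain a where a: "(saw \<longlongrightarrow> a) (at_right y)" using saw_one_sided_limits by blast
    show ?thesis
      by (rule proj_closure, rule in_closure_of_strip[OF _ a, of "\<lambda>_. True" "x - a - 1" x "x - a + 1"])
        (auto simp: proj_in_tile generic_def)
  qed
  then have "range proj \<subseteq> closure (\<Union>a\<in>addresses. tile a)" by auto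
  then show ?thesis using proj_surj by auto
qed

lemma cell_attained:
  assumes "0 \<le> i" "i < L" obtains t where "\<not> adic t" "cell t = i"
proof -
  have "i / L < (i + 1) / L" using L_ge2 by (simp add: divide_strict_right_mono)
  then obtain t where t: "i / L < t" "t < (i + 1) / L" "\<not> adic t" by (rule nonadic_between)
  have "of_int i < of_int L * t" "of_int L * t < of_int i + 1"
    using t L_ge2 by (simp_all add: field_simps)
  then have "cell t = i mod L" by (rule cell_eqI)
  then show ?thesis using t assms by (intro that) auto
qed

lemma tile_nonempty: "a \<in> addresses \<Longrightarrow> tile a \<noteq> {}"
proof -
  assume "a \<in> addresses"
  then obtain i j where a: "a = (i, j)" "0 \<le> i" "i < L" "0 \<le> j" "j < L" by (auto simp: addresses_def)
  obtain t where t: "\<not> adic t" "cell t = i" using cell_attained a by metis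
  obtain y where y: "\<not> adic y" "cell y = j" using cell_attained a by metis
  have "proj (t + saw y, y) \<in> tile a"
    using t y a by (simp add: proj_in_tile generic_def address_def)
  then show ?thesis by blast
qed

text \<open>
  At a generic point the straightened coordinates depend continuously on the point and are not
  endpoints of cells, hence the address is constant nearby, and \<open>proj\<close> is open.
\<close>
lemma generic_in_closure_tile:
  assumes "generic x y" "proj (x, y) \<in> closure (tile a)" shows "address x y = a"
proof -
  have ni: "\<not> adic y" "\<not> adic (x - saw y)" using assms(1) by (auto simp: generic_def)
  have lim: "((\<lambda>p. snd p) \<longlongrightarrow> y) (nhds (x, y))" "((\<lambda>p. fst p) \<longlongrightarrow> x) (nhds (x, y))"
    using tendsto_snd[OF filterlim_ident, of "(x,y)"] tendsto_fst[OF filterlim_ident, of "(x,y)"] by simp_all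
  have "((\<lambda>p. saw (snd p)) \<longlongrightarrow> saw y) (nhds (x, y))"
    using isCont_tendsto_compose[OF saw_continuous[OF ni(1)] lim(1)] .
  then have "((\<lambda>p. of_int L * (fst p - saw (snd p))) \<longlongrightarrow> of_int L * (x - saw y)) (nhds (x, y))"
    by (intro tendsto_intros lim)
  then have "\<forall>\<^sub>F p in nhds (x, y). \<lfloor>of_int L * (fst p - saw (snd p))\<rfloor> = \<lfloor>of_int L * (x - saw y)\<rfloor>"
    by (rule eventually_floor_eq) (use not_adic_scaled[OF ni(2)] of_L in simp)
  moreover have "((\<lambda>p. of_int L * snd p) \<longlongrightarrow> of_int L * y) (nhds (x, y))"
    by (intro tendsto_intros lim)
  then have "\<forall>\<^sub>F p in nhds (x, y). \<lfloor>of_int L * snd p\<rfloor> = \<lfloor>of_int L * y\<rfloor>"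
    by (rule eventually_floor_eq) (use not_adic_scaled[OF ni(1)] of_L in simp)
  ultimately have "\<forall>\<^sub>F p in nhds (x, y). address (fst p) (snd p) = address x y"
    by eventually_elim (simp add: address_def cell_def)
  then obtain V where V: "open V" "(x, y) \<in> V" "\<And>p. p \<in> V \<Longrightarrow> address (fst p) (snd p) = address x y"
    by (auto simp: eventually_nhds)
  have "proj ` V \<inter> tile a \<noteq> {}"
    using open_Int_closure_eq_empty[OF proj_open[OF V(1)], of "tile a"] V(2) assms(2) by blast
  then obtain x' y' where "(x', y') \<in> V" "proj (x', y') \<in> tile a" by auto
  then show ?thesis using V(3)[of "(x', y')"] by (simp add: proj_in_tile)
qed

sublocale tiling: dense_tiling addresses tile
proof
  show "finite addresses" by (simp add: addresses_def)
  show "closure (\<Union>a\<in>addresses. tile a) = UNIV" by (rule dense_tiles)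
  show "closure (tile a) \<inter> tile b = {}" if "a \<noteq> b" for a b
    using that generic_in_closure_tile unfolding tile_def by blast
qed

section \<open>The Markov property\<close>

definition partition :: "'a set set" where
  "partition = (\<lambda>a. closure (tile a)) ` addresses"

definition tile_diam :: real where "tile_diam = 2 * ((1 + 2 * \<bar>m\<bar> + real n * \<bar>m\<bar>) / l ^ n)"

lemma tile_diam_small: "(l + 1) * tile_diam < 1" "0 \<le> tile_diam" "l * tile_diam < 1"
proof -
  show nn: "0 \<le> tile_diam" using l_ge2 by (simp add: tile_diam_def)
  have *: "l * tile_diam \<le> 1 / 2" using fine unfolding tile_diam_def by argo
  moreover have "2 * tile_diam \<le> l * tile_diam" using l_ge2 nn by (intro mult_right_mono) auto
  ultimately show "(l + 1) * tile_diam < 1" by (simp only: distrib_right)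
  show "l * tile_diam < 1" using * by linarith
qed

lemma close_in_strip:
  assumes "\<lfloor>of_int L * y\<rfloor> = j" "\<not> adic y"
  shows "\<bar>y - (j + 1/2) / L\<bar> \<le> 1 / l ^ n"
    "\<bar>saw y - saw ((j + 1/2) / L)\<bar> \<le> (2 * \<bar>m\<bar> + n * \<bar>m\<bar>) / l ^ n"
proof -
  have Lpos: "0 < real_of_int L" using L_ge2 by simp
  define c where "c = (j + 1/2) / L"
  have c: "L * c = j + 1/2" using Lpos by (simp add: c_def)
  have y: "j < L * y" "L * y < j + 1" using nonadic_in_strip[OF assms(2)] assms(1) by auto
  have "\<bar>L * (y - c)\<bar> \<le> 1" using y c by (simp add: right_diff_distrib)
  then have "L * \<bar>y - c\<bar> \<le> 1" using Lpos by (simp add: abs_mult)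
  then show "\<bar>y - (j + 1/2) / L\<bar> \<le> 1 / l ^ n" using Lpos unfolding c_def of_L[symmetric] by (simp add: field_simps)
  show "\<bar>saw y - saw ((j + 1/2) / L)\<bar> \<le> (2 * \<bar>m\<bar> + n * \<bar>m\<bar>) / l ^ n"
    unfolding c_def[symmetric] by (rule saw_oscillation[of j]) (use y c in \<open>simp_all add: of_L\<close>)
qed

text \<open>
  After a lattice translation all points of a tile lie in one box of side \<open>tile_diam\<close>; the box is
  compact, so that its image also contains the closure.
\<close>
lemma member_close:
  assumes "p \<in> closure (tile a)" "q \<in> closure (tile a)"
  obtains x y x' y' where "p = proj (x, y)" "q = proj (x', y')" "\<bar>x - x'\<bar> \<le> tile_diam" "\<bar>y - y'\<bar> \<le> tile_diam"
proof -
  obtain i j where a: "a = (i, j)" by force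
  have Lpos: "0 < real_of_int L" using L_ge2 by simp
  define y0 where "y0 = (j + 1/2) / L"
  define x0 where "x0 = i / L + saw y0"
  define B where "B = cbox (x0 - tile_diam / 2, y0 - tile_diam / 2) (x0 + tile_diam / 2, y0 + tile_diam / 2)"
  have "tile a \<subseteq> proj ` B"
  proof
    fix r assume "r \<in> tile a"
    then obtain x y where xy: "r = proj (x, y)" "generic x y" "address x y = a" by (auto simp: tile_def)
    then have ni: "\<not> adic y" "\<not> adic (x - saw y)" by (auto simp: generic_def)
    define u v where "u = \<lfloor>of_int L * y\<rfloor> div L" "v = \<lfloor>of_int L * (x - saw y)\<rfloor> div L"
    have fl: "\<lfloor>of_int L * y\<rfloor> = L * u + j" "\<lfloor>of_int L * (x - saw y)\<rfloor> = L * v + i"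
      using xy(3) mult_div_mod_eq[of L "\<lfloor>of_int L * y\<rfloor>"] mult_div_mod_eq[of L "\<lfloor>of_int L * (x - saw y)\<rfloor>"]
      unfolding a address_def cell_def u_v_def by auto
    define y1 x1 where "y1 = y - u" "x1 = x - v"
    have saw1: "saw y1 = saw y" using saw_periodic[of "- of_int u" y] by (simp add: y1_x1_def)
    have r: "r = proj (x1, y1)" using xy(1) by (simp add: proj_eq y1_x1_def)
    have "\<lfloor>of_int L * y1\<rfloor> = j"
    proof -
      have "of_int L * y1 = of_int L * y - of_int (L * u)" by (simp add: y1_x1_def right_diff_distrib)
      then show ?thesis using fl(1) by (simp only: floor_diff_of_int)
    qed
    moreover have "\<not> adic y1" using ni(1) adic_add_Int[of "- of_int u" y] by (simp add: y1_x1_def)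
    ultimately have cl: "\<bar>y1 - y0\<bar> \<le> 1 / l ^ n" "\<bar>saw y1 - saw y0\<bar> \<le> (2 * \<bar>m\<bar> + n * \<bar>m\<bar>) / l ^ n"
      unfolding y0_def by (rule close_in_strip)+
    have xi: "L * (x1 - saw y1) = L * (x - saw y) - L * v"
      unfolding saw1 by (simp add: y1_x1_def algebra_simps)
    have "\<bar>L * (x1 - saw y1) - i\<bar> \<le> 1"
      using floor_correct[of "of_int L * (x - saw y)"] fl(2) unfolding xi by auto
    then have "\<bar>L * (x1 - saw y1 - i / L)\<bar> \<le> 1" using Lpos by (simp add: right_diff_distrib)
    then have "L * \<bar>x1 - saw y1 - i / L\<bar> \<le> 1" using Lpos by (simp add: abs_mult)
    then have "\<bar>x1 - saw y1 - i / L\<bar> \<le> 1 / l ^ n" using Lpos unfolding of_L[symmetric] by (simp add: field_simps)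
    then have "\<bar>x1 - x0\<bar> \<le> 1 / l ^ n + (2 * \<bar>m\<bar> + n * \<bar>m\<bar>) / l ^ n" unfolding x0_def using cl(2) by linarith
    also have "\<dots> = tile_diam / 2" by (simp add: tile_diam_def add_divide_distrib)
    finally have 1: "\<bar>x1 - x0\<bar> \<le> tile_diam / 2" .
    have "\<bar>y1 - y0\<bar> \<le> 1 / l ^ n + (2 * \<bar>m\<bar> + n * \<bar>m\<bar>) / l ^ n"
      using cl(1) by (rule order_trans) (use l_ge2 in simp)
    also have "\<dots> = tile_diam / 2" by (simp add: tile_diam_def add_divide_distrib)
    finally have 2: "\<bar>y1 - y0\<bar> \<le> tile_diam / 2" .
    have "x0 - tile_diam / 2 \<le> x1" "x1 \<le> x0 + tile_diam / 2" "y0 - tile_diam / 2 \<le> y1" "y1 \<le> y0 + tile_diam / 2"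
      using 1 2 by linarith+
    then have "(x1, y1) \<in> B" unfolding B_def cbox_Pair_eq by simp
    then show "r \<in> proj ` B" using r by blast
  qed
  moreover have "compact (proj ` B)"
    using proj_cont by (intro compact_continuous_image) (auto simp: B_def intro: continuous_on_subset)
  ultimately have sub: "closure (tile a) \<subseteq> proj ` B" by (intro closure_minimal compact_imp_closed)
  obtain x y where 1: "p = proj (x, y)" "(x, y) \<in> B" using sub assms(1) by auto
  obtain x' y' where 2: "q = proj (x', y')" "(x', y') \<in> B" using sub assms(2) by auto
  have "\<bar>x - x'\<bar> \<le> tile_diam" "\<bar>y - y'\<bar> \<le> tile_diam"
    using 1(2) 2(2) unfolding B_def cbox_Pair_eq by auto
  then show ?thesis using that 1(1) 2(1) by blast
qed

text \<open>
  The hypothesis provides a generic point of tile \<open>a\<close> whose image lies in tile \<open>b\<close>. Any other point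
  of tile \<open>b\<close> is then lifted into tile \<open>a\<close> separately in both straightened coordinates.
\<close>
lemma f_image_tile:
  assumes "f ` interior (closure (tile a)) \<inter> interior (closure (tile b)) \<noteq> {}"
    and ab: "a \<in> addresses" "b \<in> addresses"
  shows "tile b \<subseteq> f ` tile a"
proof -
  let ?W = "(\<lambda>(x, y). (lam * x + m * y, lam * y)) -` (proj -` interior (closure (tile b)))"
  let ?U = "proj -` interior (closure (tile a)) \<inter> ?W"
  have cont: "continuous_on UNIV (\<lambda>(x, y). (lam * x + m * y, lam * y))"
    by (auto simp: case_prod_unfold intro!: continuous_intros)
  have "open ?U"
    by (intro open_Int open_vimage[OF _ cont] open_vimage[OF _ proj_cont]) auto
  obtain p where p: "p \<in> interior (closure (tile a))" "f p \<in> interior (closure (tile b))"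
    using assms(1) by blast
  obtain x y where "p = proj (x, y)" using proj_surj by (metis rangeE surj_pair UNIV_I)
  then have "(x, y) \<in> ?U" using p by (simp add: f_proj)
  then have "open (proj ` ?U)" "proj ` ?U \<noteq> {}"
    using \<open>open ?U\<close> proj_open by blast+
  then obtain d where d: "d \<in> addresses" "proj ` ?U \<inter> tile d \<noteq> {}" by (rule tiling.interior_meets_tile)
  then obtain z where z: "z \<in> ?U" "proj z \<in> tile d" by blast
  moreover obtain x y where "z = (x, y)" by force
  ultimately have xy: "(x, y) \<in> ?U" "generic x y" by (auto simp only: proj_in_tile)
  have "proj (x, y) \<in> closure (tile a)" "proj (lam * x + m * y, lam * y) \<in> closure (tile b)"
    using xy(1) interior_subset by auto
  then have addr: "address x y = a" "address (lam * x + m * y) (lam * y) = b"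
    using generic_in_closure_tile generic_image(1) xy(2) by blast+
  have ni: "\<not> adic y" "\<not> adic (x - saw y)" using xy(2) by (auto simp: generic_def)
  show ?thesis
  proof
    fix w assume "w \<in> tile b"
    then obtain x' y' where w: "w = proj (x', y')" "generic x' y'" "address x' y' = b"
      by (auto simp: tile_def)
    then have ni': "\<not> adic y'" "\<not> adic (x' - saw y')" by (auto simp: generic_def)
    have cells: "cell (x' - saw y') = cell (lam * (x - saw y))" "cell y' = cell (lam * y)"
      using w(3) addr(2) generic_image(2)[OF xy(2)] by (auto simp: address_def)
    obtain y1 where y1: "\<not> adic y1" "cell y1 = cell y" "lam * y1 - y' \<in> \<int>"
      using cell_pullback[OF ni(1) ni'(1) cells(2)] .
    obtain t where t: "\<not> adic t" "cell t = cell (x - saw y)" "lam * t - (x' - saw y') \<in> \<int>"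
      using cell_pullback[OF ni(2) ni'(2) cells(1)] .
    define x1 where "x1 = t + saw y1"
    have "proj (x1, y1) \<in> tile a"
      using y1 t addr(1) by (simp add: proj_in_tile generic_def address_def x1_def)
    moreover have "f (proj (x1, y1)) = w"
    proof -
      have "saw (lam * y1) = saw y'" using saw_periodic[OF y1(3), of y'] by simp
      then have "lam * x1 + m * y1 - x' = (lam * t - (x' - saw y')) + m * \<lfloor>y1\<rfloor>"
        using straighten[of x1 y1] by (simp add: x1_def)
      also have "\<dots> \<in> \<int>" using t(3) m_Int by (intro Ints_add Ints_mult) auto
      finally show ?thesis using y1(3) by (simp add: f_proj w(1) proj_eq)
    qed
    ultimately show "w \<in> f ` tile a" by blast
  qed
qed

lemma compact_UNIV: "compact (UNIV :: 'a set)"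
proof -
  have "p \<in> proj ` cbox (0, 0) (1, 1)" for p
  proof -
    obtain x y where "p = proj (x, y)" using proj_surj by (metis rangeE surj_pair UNIV_I)
    then have "p = proj (frac x, frac y)" by (simp add: proj_eq frac_def)
    moreover have "(frac x, frac y) \<in> cbox (0, 0) (1, 1)"
      by (simp add: cbox_Pair_eq less_imp_le[OF frac_lt_1])
    ultimately show ?thesis by blast
  qed
  then have "UNIV = proj ` cbox (0, 0) (1, 1)" by blast
  also have "compact \<dots>" by (intro compact_continuous_image continuous_on_subset[OF proj_cont]) auto
  finally show ?thesis .
qed

lemma f_cont: "continuous_on UNIV f"
  unfolding continuous_on_open_vimage[OF open_UNIV]
proof (intro allI impI)
  fix B :: "'a set" assume "open B"
  let ?h = "\<lambda>(x, y). (lam * x + m * y, lam * y)"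
  have "continuous_on UNIV ?h"
    by (auto simp: case_prod_unfold intro!: continuous_intros)
  then have "open (?h -` (proj -` B))"
    using \<open>open B\<close> by (intro open_vimage proj_cont)
  then have "open (proj ` (?h -` (proj -` B)))" by (rule proj_open)
  also have "proj ` (?h -` (proj -` B)) = f -` B"
  proof
    show "proj ` (?h -` (proj -` B)) \<subseteq> f -` B" by (auto simp: f_proj)
    show "f -` B \<subseteq> proj ` (?h -` (proj -` B))"
    proof
      fix p assume p: "p \<in> f -` B"
      obtain x y where "p = proj (x, y)" using proj_surj by (metis rangeE surj_pair UNIV_I)
      then show "p \<in> proj ` (?h -` (proj -` B))" using p by (auto simp: f_proj intro!: image_eqI[of _ _ "(x, y)"])
    qed
  qed
  finally show "open (f -` B \<inter> UNIV)" by simp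
qed

lemma f_covers_tile:
  assumes "tile b \<subseteq> f ` tile a" shows "closure (tile b) \<subseteq> f ` closure (tile a)"
proof (rule closure_minimal)
  show "tile b \<subseteq> f ` closure (tile a)" using assms closure_subset[of "tile a"] by blast
  have "compact (closure (tile a))" 
    using compact_Int_closed[OF compact_UNIV closed_closure, of "tile a"] by simp
  then have "compact (f ` closure (tile a))"
    by (intro compact_continuous_image continuous_on_subset[OF f_cont]) auto
  then show "closed (f ` closure (tile a))" by (rule compact_imp_closed)
qed

lemma f_inj_on_tile: "inj_on f (closure (tile a))"
proof (rule inj_onI)
  fix p q assume "p \<in> closure (tile a)" "q \<in> closure (tile a)" "f p = f q"
  from this(1,2) obtain x y x' y' where pq: "p = proj (x, y)" "q = proj (x', y')" "\<bar>x - x'\<bar> \<le> tile_diam" "\<bar>y - y'\<bar> \<le> tile_diam"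
    by (rule member_close)
  have zero: "d = 0" if "\<bar>d\<bar> \<le> tile_diam" "lam * d \<in> \<int>" for d
  proof -
    have "\<bar>lam * d\<bar> \<le> l * tile_diam" unfolding abs_mult using that by (intro mult_left_mono) auto
    then have "\<bar>lam * d\<bar> < 1" using tile_diam_small by linarith
    then have "lam * d = 0" using that(2) Ints_nonzero_abs_less1 by blast
    then show ?thesis by simp
  qed
  have ints: "(lam * x + m * y) - (lam * x' + m * y') \<in> \<int>" "lam * y - lam * y' \<in> \<int>"
    using \<open>f p = f q\<close> by (simp_all add: pq f_proj proj_eq)
  have "y - y' = 0" using ints(2) pq(4) by (intro zero) (simp_all add: right_diff_distrib)
  moreover from this have "x - x' = 0" using ints(1) pq(3) by (intro zero) (simp_all add: right_diff_distrib)
  ultimately show "p = q" using pq by simp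
qed

lemma f_iterate: "\<exists>r. \<forall>x y. (f ^^ k) (proj (x, y)) = proj (lam ^ k * x + r * y, lam ^ k * y)"
proof (induction k)
  case 0 show ?case by (intro exI[of _ 0]) simp
next
  case (Suc k)
  then obtain r where r: "\<And>x y. (f ^^ k) (proj (x, y)) = proj (lam ^ k * x + r * y, lam ^ k * y)" by blast
  show ?case by (intro exI[of _ "lam * r + m * lam ^ k"]) (simp add: r f_proj algebra_simps)
qed

text \<open>
  Expansion is applied to the second coordinate first. Once the second coordinates agree, the
  shear no longer contributes to the difference of the first ones.
\<close>
lemma itinerary_unique:
  assumes "\<And>k. (f ^^ k) p \<in> closure (tile (a k))" "\<And>k. (f ^^ k) q \<in> closure (tile (a k))"
  shows "p = q"
proof -
  have "p \<in> closure (tile (a 0))" "q \<in> closure (tile (a 0))" using assms[of 0] by simp_all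
  then obtain x y x' y' where pq: "p = proj (x, y)" "q = proj (x', y')"
      "\<bar>x - x'\<bar> \<le> tile_diam" "\<bar>y - y'\<bar> \<le> tile_diam"
    by (rule member_close)
  have near: "\<exists>r. (\<exists>z\<in>\<int>. \<bar>lam ^ k * (x - x') + r * (y - y') - z\<bar> \<le> tile_diam) \<and>
      (\<exists>z\<in>\<int>. \<bar>lam ^ k * (y - y') - z\<bar> \<le> tile_diam)" for k
  proof -
    obtain r where r: "\<And>x y. (f ^^ k) (proj (x, y)) = proj (lam ^ k * x + r * y, lam ^ k * y)"
      using f_iterate by blast
    obtain u v u' v' where uv: "(f ^^ k) p = proj (u, v)" "(f ^^ k) q = proj (u', v')"
      "\<bar>u - u'\<bar> \<le> tile_diam" "\<bar>v - v'\<bar> \<le> tile_diam"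
      using member_close[OF assms] by metis
    have ints: "lam ^ k * x + r * y - u \<in> \<int>" "lam ^ k * y - v \<in> \<int>"
      "lam ^ k * x' + r * y' - u' \<in> \<int>" "lam ^ k * y' - v' \<in> \<int>"
      using uv(1,2) by (simp_all add: pq r proj_eq)
    have eq: "lam ^ k * (x - x') + r * (y - y') -
        ((lam ^ k * x + r * y - u) - (lam ^ k * x' + r * y' - u')) = u - u'"
      "lam ^ k * (y - y') - ((lam ^ k * y - v) - (lam ^ k * y' - v')) = v - v'"
      by (simp_all add: algebra_simps)
    show ?thesis
      using uv(3,4) unfolding eq[symmetric] using ints by (blast intro: Ints_diff)
  qed
  have "y - y' = 0"
    by (rule expanding_near_Ints_eq_0[OF tile_diam_small(1) pq(4)]) (use near in blast)
  moreover from this have "x - x' = 0"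
    by (intro expanding_near_Ints_eq_0[OF tile_diam_small(1) pq(3)]) (use near in simp)
  ultimately show ?thesis using pq by simp
qed

theorem markov: "markov_partition f partition"
  unfolding markov_partition_def
proof (intro conjI ballI allI impI)
  show "finite partition" by (simp add: partition_def tiling.finite_I)
  show "\<Union>partition = UNIV" using tiling.Union_closure_tiles by (simp add: partition_def)
  show "proper_set R" if "R \<in> partition" for R
    using that tiling.proper_closure_tile tile_nonempty by (auto simp: partition_def proper_set_def)
  show "interior R \<inter> interior R' = {}" if "R \<in> partition" "R' \<in> partition" "R \<noteq> R'" for R R'
    using that tiling.disjoint_interiors unfolding partition_def by blast
  show "p = q" if "\<forall>k. x k \<in> partition"
    "p \<in> (\<Inter>k. (f ^^ k) -` interior (x k)) \<and> q \<in> (\<Inter>k. (f ^^ k) -` interior (x k))" for x p q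
  proof -
    have "\<exists>b. x k = closure (tile b)" for k
      using that(1) unfolding partition_def by blast
    then have "\<exists>a. \<forall>k. x k = closure (tile (a k))" by metis
    then obtain a where a: "\<And>k. x k = closure (tile (a k))" by blast
    show ?thesis
    proof (rule itinerary_unique)
      show "(f ^^ k) p \<in> closure (tile (a k))" for k
        using that(2) interior_subset[of "x k"] unfolding a[symmetric] by blast
      show "(f ^^ k) q \<in> closure (tile (a k))" for k
        using that(2) interior_subset[of "x k"] unfolding a[symmetric] by blast
    qed
  qed
  show "\<exists>!z. z \<in> R \<and> f z = w" if RR: "R \<in> partition" "R' \<in> partition"
    "f ` interior R \<inter> interior R' \<noteq> {}" "w \<in> interior R'" for R R' w
  proof -
    obtain a b where ab: "a \<in> addresses" "b \<in> addresses" "R = closure (tile a)" "R' = closure (tile b)"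
      using RR by (auto simp: partition_def)
    have "w \<in> f ` R"
      using f_covers_tile[OF f_image_tile[of a b]] RR(3,4) ab interior_subset by blast
    then show ?thesis using f_inj_on_tile[of a] ab(3) by (auto simp: inj_on_def)
  qed
qed

end

section \<open>Length of the boundary\<close>

text \<open>
  Cut the parameter interval into pieces on which the curve moves by less than \<open>d\<close>; each contains
  the parameter of at most one point of \<open>S\<close>.
\<close>
lemma card_separated_on_Lipschitz_curve:
  fixes g :: "real \<Rightarrow> 'a::metric_space" and d :: real
  assumes lip: "\<And>s t. s \<in> {0..1} \<Longrightarrow> t \<in> {0..1} \<Longrightarrow> dist (g s) (g t) \<le> K * \<bar>s - t\<bar>" and "0 < K"
    and S: "S \<subseteq> g ` {0..1}" and sep: "\<And>p q. p \<in> S \<Longrightarrow> q \<in> S \<Longrightarrow> p \<noteq> q \<Longrightarrow> d \<le> dist p q" and "0 < d"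
  shows "real (card S) * d \<le> 2 * K + d"
proof -
  have "\<forall>p\<in>S. \<exists>t. t \<in> {0..1} \<and> g t = p" using S by blast
  from bchoice[OF this] obtain t where t: "\<And>p. p \<in> S \<Longrightarrow> t p \<in> {0..1} \<and> g (t p) = p" by blast
  define h where "h p = nat \<lfloor>t p * (2 * K / d)\<rfloor>" for p
  have pos: "0 < 2 * K / d" using assms by simp
  have "inj_on h S"
  proof (rule inj_onI, rule ccontr)
    fix p q assume pq: "p \<in> S" "q \<in> S" "h p = h q" "p \<noteq> q"
    have "0 \<le> t p * (2 * K / d)" "0 \<le> t q * (2 * K / d)"
      using t[OF pq(1)] t[OF pq(2)] pos by (auto intro!: mult_nonneg_nonneg simp del: times_divide_eq_right)
    then have "\<lfloor>t p * (2 * K / d)\<rfloor> = \<lfloor>t q * (2 * K / d)\<rfloor>"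
      using pq(3) by (simp add: h_def nat_eq_iff)
    then have "\<bar>t p * (2 * K / d) - t q * (2 * K / d)\<bar> < 1" by linarith
    then have "\<bar>t p - t q\<bar> * (2 * K / d) < 1" 
      using pos unfolding left_diff_distrib[symmetric] abs_mult by (simp only: abs_of_pos)
    then have "K * \<bar>t p - t q\<bar> < d"
      using assms by (simp add: field_simps)
    then have "dist (g (t p)) (g (t q)) < d" using lip[of "t p" "t q"] t pq by fastforce
    then show False using t pq sep[of p q] by fastforce
  qed
  moreover have "h ` S \<subseteq> {..nat \<lfloor>2 * K / d\<rfloor>}"
  proof
    fix k assume "k \<in> h ` S"
    then obtain p where p: "p \<in> S" "k = h p" by blast
    have "t p * (2 * K / d) \<le> 1 * (2 * K / d)" using t[OF p(1)] pos by (intro mult_right_mono) auto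
    then show "k \<in> {..nat \<lfloor>2 * K / d\<rfloor>}" unfolding p(2) h_def by (auto intro!: nat_mono floor_mono)
  qed
  ultimately have "card S \<le> card {..nat \<lfloor>2 * K / d\<rfloor>}" by (intro card_inj_on_le) auto
  then have "real (card S) \<le> real (nat \<lfloor>2 * K / d\<rfloor>) + 1" by simp
  also have "\<dots> \<le> 2 * K / d + 1" using pos by (simp add: of_nat_floor)
  finally have "real (card S) * d \<le> (2 * K / d + 1) * d" using \<open>0 < d\<close> by (intro mult_right_mono) auto
  then show ?thesis using \<open>0 < d\<close> by (simp add: distrib_right)
qed

lemma separated_bound_Lipschitz_curves:
  fixes F :: "'a::metric_space set set"
  assumes "finite F"
    and "\<And>C. C \<in> F \<Longrightarrow> \<exists>g K. C = g ` {0..1::real} \<and> 0 < K \<and>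
      (\<forall>s\<in>{0..1}. \<forall>t\<in>{0..1}. dist (g s) (g t) \<le> K * \<bar>s - t\<bar>)"
  shows "\<exists>B. \<forall>S (d::real). finite S \<and> S \<subseteq> \<Union>F \<and> 0 < d \<and> d \<le> 1 \<and>
      (\<forall>p\<in>S. \<forall>q\<in>S. p \<noteq> q \<longrightarrow> d \<le> dist p q) \<longrightarrow> real (card S) * d \<le> B"
proof -
  have "\<forall>C\<in>F. \<exists>w. C = fst w ` {0..1::real} \<and> 0 < snd w \<and>
      (\<forall>s\<in>{0..1}. \<forall>t\<in>{0..1}. dist (fst w s) (fst w t) \<le> snd w * \<bar>s - t\<bar>)"
    using assms(2) by auto
  from bchoice[OF this] obtain w where w: "\<forall>C\<in>F. C = fst (w C) ` {0..1::real} \<and> 0 < snd (w C) \<and>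
      (\<forall>s\<in>{0..1}. \<forall>t\<in>{0..1}. dist (fst (w C) s) (fst (w C) t) \<le> snd (w C) * \<bar>s - t\<bar>)" ..
  define g where "g C = fst (w C)" for C
  define K where "K C = snd (w C)" for C
  have gK0: "\<forall>C\<in>F. C = g C ` {0..1::real} \<and> 0 < K C \<and>
      (\<forall>s\<in>{0..1}. \<forall>t\<in>{0..1}. dist (g C s) (g C t) \<le> K C * \<bar>s - t\<bar>)"
    unfolding g_def K_def by (rule w)
  have gK: "C = g C ` {0..1::real}" "0 < K C"
    "\<And>s t. s \<in> {0..1} \<Longrightarrow> t \<in> {0..1} \<Longrightarrow> dist (g C s) (g C t) \<le> K C * \<bar>s - t\<bar>" if "C \<in> F" for C
    using gK0[rule_format, OF that] by blast+
  show ?thesis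
  proof (intro exI[of _ "\<Sum>C\<in>F. 2 * K C + 1"] allI impI)
    fix S and d :: real
    assume "finite S \<and> S \<subseteq> \<Union>F \<and> 0 < d \<and> d \<le> 1 \<and> (\<forall>p\<in>S. \<forall>q\<in>S. p \<noteq> q \<longrightarrow> d \<le> dist p q)"
    then have S: "finite S" "S \<subseteq> \<Union>F" "0 < d" "d \<le> 1"
      "\<And>p q. p \<in> S \<Longrightarrow> q \<in> S \<Longrightarrow> p \<noteq> q \<Longrightarrow> d \<le> dist p q"
      by blast+
    have "S = (\<Union>C\<in>F. S \<inter> C)" using S(2) by blast
    then have "card S \<le> (\<Sum>C\<in>F. card (S \<inter> C))" using card_UN_le[OF assms(1), of "\<lambda>C. S \<inter> C"] by (rule ssubst)
    then have "real (card S) * d \<le> real (\<Sum>C\<in>F. card (S \<inter> C)) * d"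
      using S(3) by (intro mult_right_mono) (auto simp del: of_nat_sum)
    also have "\<dots> = (\<Sum>C\<in>F. card (S \<inter> C) * d)" by (simp add: sum_distrib_right)
    also have "\<dots> \<le> (\<Sum>C\<in>F. 2 * K C + 1)"
    proof (rule sum_mono)
      fix C assume C: "C \<in> F"
      have "real (card (S \<inter> C)) * d \<le> 2 * K C + d"
      proof (rule card_separated_on_Lipschitz_curve[of "g C"])
        show "S \<inter> C \<subseteq> g C ` {0..1}" using gK(1)[OF C] by blast
        show "d \<le> dist p q" if "p \<in> S \<inter> C" "q \<in> S \<inter> C" "p \<noteq> q" for p q
          using that by (intro S(5)) auto
      qed (fact gK(3)[OF C], fact gK(2)[OF C], fact S(3))
      then show "real (card (S \<inter> C)) * d \<le> 2 * K C + 1" using S(4) by linarith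
    qed
    finally show "real (card S) * d \<le> (\<Sum>C\<in>F. 2 * K C + 1)" .
  qed
qed

context sheared_endomorphism
begin

lemma overlap_in_boundary:
  assumes "a \<in> addresses" "b \<in> addresses" "a \<noteq> b" "p \<in> closure (tile a)" "p \<in> closure (tile b)"
  shows "p \<in> partition_boundary partition"
  using tiling.overlap_subset_frontier[OF assms(1-3)] assms
  by (auto simp: partition_boundary_def partition_def)

text \<open>
  Membership in the closure of a tile, tested from above or from below. The two tests use
  different limits of the series, so they can give different tiles.
\<close>
lemma in_closure_tile_from_side:
  assumes S: "S = {y<..} \<or> S = {..<y}" and lim: "(saw \<longlongrightarrow> a) (at y within S)"
    and j: "\<forall>\<^sub>F t in at y within S. \<lfloor>of_int L * t\<rfloor> = j"
    and i: "of_int i \<le> of_int L * (x - a)" "of_int L * (x - a) \<le> of_int i + 1"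
  shows "proj (x, y) \<in> closure (tile (i mod L, j mod L))"
proof (rule proj_closure)
  have Lpos: "0 < real_of_int L" using L_ge2 by simp
  show "(x, y) \<in> closure {(x', y'). \<not> adic y' \<and> \<lfloor>of_int L * y'\<rfloor> = j \<and> \<not> adic (x' - saw y') \<and>
    of_int i / of_int L < x' - saw y' \<and> x' - saw y' < (of_int i + 1) / of_int L}"
    by (rule in_closure_of_strip[OF S lim j]) (use i Lpos in \<open>auto simp: field_simps\<close>)
  show "proj ` {(x', y'). \<not> adic y' \<and> \<lfloor>of_int L * y'\<rfloor> = j \<and> \<not> adic (x' - saw y') \<and>
    of_int i / of_int L < x' - saw y' \<and> x' - saw y' < (of_int i + 1) / of_int L} \<subseteq> tile (i mod L, j mod L)"
  proof clarify
    fix x' y' assume *: "\<not> adic y'" "j = \<lfloor>of_int L * y'\<rfloor>" "\<not> adic (x' - saw y')"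
      "of_int i / of_int L < x' - saw y'" "x' - saw y' < (of_int i + 1) / of_int L"
    have "cell (x' - saw y') = i mod L"
      by (rule cell_eqI) (use * Lpos in \<open>auto simp: field_simps\<close>)
    then show "proj (x', y') \<in> tile (i mod L, \<lfloor>of_int L * y'\<rfloor> mod L)"
      using * by (simp add: proj_in_tile generic_def address_def cell_def)
  qed
qed

lemma floor_right:
  fixes y :: real
  shows "\<forall>\<^sub>F t in at_right y. \<lfloor>of_int L * t\<rfloor> = \<lfloor>of_int L * y\<rfloor>"
proof -
  have Lpos: "0 < real_of_int L" using L_ge2 by simp
  have "((\<lambda>t. of_int L * t) \<longlongrightarrow> of_int L * y) (at_right y)" by (intro tendsto_intros)
  then have "\<forall>\<^sub>F t in at_right y. of_int L * t < of_int \<lfloor>of_int L * y\<rfloor> + 1"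
    by (rule order_tendstoD(2)) linarith
  moreover have "\<forall>\<^sub>F t in at_right y. y < t" by (rule eventually_at_right_less)
  ultimately show ?thesis
  proof eventually_elim
    case (elim t)
    have "of_int L * y < of_int L * t" using elim(2) Lpos by simp
    then show ?case using elim(1) by (intro floor_unique) linarith+
  qed
qed

lemma floor_left:
  fixes y :: real
  shows "\<forall>\<^sub>F t in at_left y. \<lfloor>of_int L * t\<rfloor> = \<lceil>of_int L * y\<rceil> - 1"
proof -
  have Lpos: "0 < real_of_int L" using L_ge2 by simp
  have "((\<lambda>t. of_int L * t) \<longlongrightarrow> of_int L * y) (at_left y)" by (intro tendsto_intros)
  then have "\<forall>\<^sub>F t in at_left y. of_int \<lceil>of_int L * y\<rceil> - 1 < of_int L * t"
    by (rule order_tendstoD(1)) linarith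
  moreover have "\<forall>\<^sub>F t in at_left y. t < y" by (simp add: eventually_at_filter)
  ultimately show ?thesis
  proof eventually_elim
    case (elim t)
    have "of_int L * t < of_int L * y" using elim(2) Lpos by simp
    then show ?case using elim(1) by (intro floor_unique) linarith+
  qed
qed

text \<open>
  The circle is approached from above by tiles with second cell \<open>0\<close> and from below by tiles with
  second cell \<open>L - 1\<close>.
\<close>
lemma horizontal_circle_in_boundary: "proj (x, 0) \<in> partition_boundary partition"
proof -
  obtain a b where ab: "(saw \<longlongrightarrow> a) (at_right 0)" "(saw \<longlongrightarrow> b) (at_left 0)"
    using saw_one_sided_limits by blast
  define i where "i = \<lfloor>of_int L * (x - a)\<rfloor>"
  define i' where "i' = \<lfloor>of_int L * (x - b)\<rfloor>"
  have r: "proj (x, 0) \<in> closure (tile (i mod L, 0 mod L))"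
    by (rule in_closure_tile_from_side[OF _ ab(1)])
      (use floor_right[of 0] in \<open>simp_all add: i_def less_imp_le[OF floor_correct[THEN conjunct2]]\<close>)
  have lf: "proj (x, 0) \<in> closure (tile (i' mod L, (-1) mod L))"
    by (rule in_closure_tile_from_side[OF _ ab(2)])
      (use floor_left[of 0] in \<open>simp_all add: i'_def less_imp_le[OF floor_correct[THEN conjunct2]]\<close>)
  have m1: "(-1) mod L = L - 1" using L_ge2 by (simp add: zmod_minus1)
  show ?thesis
    by (rule overlap_in_boundary[OF _ _ _ r lf]) (use L_ge2 m1 in \<open>auto simp: addresses_def\<close>)
qed

text \<open>
  For a point between the two limits, the offsets from the left and from the right limit have
  opposite signs. As the jump is at most the width of a cell, one of them falls into cell \<open>0\<close> and the
  other one into cell \<open>-1\<close>, so the closures of two different tiles contain the point.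
\<close>
lemma jump_segment_in_boundary:
  assumes lim: "(saw \<longlongrightarrow> a) (at_right y)" "(saw \<longlongrightarrow> b) (at_left y)"
    and small: "of_int L * \<bar>a - b\<bar> \<le> 1" and th: "0 \<le> t" "t \<le> 1"
  shows "proj (b + t * (a - b), y) \<in> partition_boundary partition"
proof -
  have Lpos: "0 < real_of_int L" using L_ge2 by simp
  define x where "x = b + t * (a - b)"
  define j where "j = \<lfloor>of_int L * y\<rfloor>"
  define j' where "j' = \<lceil>of_int L * y\<rceil> - 1"
  have in_right: "proj (x, y) \<in> closure (tile (i mod L, j mod L))"
    if "of_int i \<le> of_int L * (x - a)" "of_int L * (x - a) \<le> of_int i + 1" for i
    by (rule in_closure_tile_from_side[OF _ lim(1) _ that]) (use floor_right in \<open>auto simp: j_def\<close>)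
  have in_left: "proj (x, y) \<in> closure (tile (i mod L, j' mod L))"
    if "of_int i \<le> of_int L * (x - b)" "of_int L * (x - b) \<le> of_int i + 1" for i
    by (rule in_closure_tile_from_side[OF _ lim(2) _ that]) (use floor_left in \<open>auto simp: j'_def\<close>)
  have m1: "(-1) mod L = L - 1" using L_ge2 by (simp add: zmod_minus1)
  define D where "D = of_int L * (a - b)"
  have D: "\<bar>D\<bar> \<le> 1" using small Lpos by (simp add: D_def abs_mult)
  have xb: "of_int L * (x - b) = t * D" and xa: "of_int L * (x - a) = - ((1 - t) * D)"
    by (simp_all add: x_def D_def algebra_simps)
  have bd: "\<bar>t * D\<bar> \<le> 1" "\<bar>(1 - t) * D\<bar> \<le> 1"
    unfolding abs_mult using D th by (auto intro!: mult_le_one)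
  have "proj (x, y) \<in> partition_boundary partition"
  proof (cases "0 \<le> D")
    case True
    have 1: "0 \<le> t * D" "0 \<le> (1 - t) * D" using True th by auto
    have "proj (x, y) \<in> closure (tile ((-1) mod L, j mod L))"
      by (rule in_right; unfold xa; use 1 bd in simp)
    moreover have "proj (x, y) \<in> closure (tile (0 mod L, j' mod L))"
      by (rule in_left; unfold xb; use 1 bd in simp)
    ultimately show ?thesis
      by (rule overlap_in_boundary[rotated 3]) (use L_ge2 m1 in \<open>auto simp: addresses_def\<close>)
  next
    case False
    have 1: "t * D \<le> 0" "(1 - t) * D \<le> 0" using False th by (auto simp: mult_nonneg_nonpos)
    have "proj (x, y) \<in> closure (tile (0 mod L, j mod L))"
      by (rule in_right; unfold xa; use 1 bd in simp)
    moreover have "proj (x, y) \<in> closure (tile ((-1) mod L, j' mod L))"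
      by (rule in_left; unfold xb; use 1 bd in simp)
    ultimately show ?thesis
      by (rule overlap_in_boundary[rotated 3]) (use L_ge2 m1 in \<open>auto simp: addresses_def\<close>)
  qed
  then show ?thesis by (simp add: x_def)
qed

text \<open>
  For \<open>k0 \<le> k < N\<close> take the heights \<open>(l j + 1) / l^(k+1)\<close> with \<open>j < l^k\<close>, which are adic of exact order
  \<open>k + 1\<close>. The jump there has size \<open>J / l^(k+1)\<close>; divide the corresponding boundary segment into
  \<open>l^(N-k)\<close> steps. Every \<open>k\<close> yields \<open>l^N\<close> points. Different heights are multiples of \<open>l^-N\<close>, and points
  at the same height are at least \<open>J / l^(N+1)\<close> apart, so the separation is of order \<open>l^-N\<close> and independent
  of \<open>k\<close>. The number \<open>k0\<close> is chosen such that the jumps do not exceed the width of a cell.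
\<close>
lemma separated_sets_in_boundary:
  "\<exists>e k0. 0 < e \<and> e \<le> 1 \<and> (\<forall>N. \<exists>S. finite S \<and> S \<subseteq> partition_boundary partition \<and>
    real (card S) = real (N - k0) * l ^ N \<and> (\<forall>p\<in>S. \<forall>q\<in>S. p \<noteq> q \<longrightarrow> e / l ^ N \<le> dist p q))"
proof -
  define b where "b = nat \<lfloor>l\<rfloor>"
  have b: "real b = l" "2 \<le> b"
  proof -
    have "of_int \<lfloor>l\<rfloor> = l" using lam_Int by (metis Ints_abs Ints_cases floor_of_int)
    then show "real b = l" using l_ge2 by (simp add: b_def)
    then show "2 \<le> b" using l_ge2 by linarith
  qed
  define J where "J = \<bar>m\<bar> / (l - 1)"
  have J: "0 < J" using m_nz l_ge2 by (simp add: J_def)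
  have lpos: "0 < l" using l_ge2 by simp
  obtain r u where ru: "\<And>y. (saw \<longlongrightarrow> r y) (at_right y)" "\<And>y. (saw \<longlongrightarrow> u y) (at_left y)"
    using saw_one_sided_limits by metis
  obtain k0 where "L * J < l ^ k0" using real_arch_pow[of l "L * J"] l_ge2 by auto
  then have k0: "L * (J / l ^ Suc k) \<le> 1" if "k0 \<le> k" for k
  proof -
    have "l ^ k0 \<le> l ^ Suc k" using that l_ge2 by (intro power_increasing) auto
    then have "L * J \<le> l ^ Suc k" using \<open>L * J < l ^ k0\<close> by linarith
    then show ?thesis using lpos by (simp add: field_simps)
  qed
  define e where "e = min 1 (c * min 1 (J / l))"
  have e: "0 < e" "e \<le> 1" "e \<le> c" "e \<le> c * (J / l)"
  proof -
    show "0 < e" "e \<le> 1" using c_pos J lpos by (auto simp: e_def)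
    have "c * min 1 (J / l) \<le> c * 1" "c * min 1 (J / l) \<le> c * (J / l)"
      using c_pos by (intro mult_left_mono; simp)+
    then show "e \<le> c" "e \<le> c * (J / l)" by (auto simp: e_def)
  qed
  have "\<exists>S. finite S \<and> S \<subseteq> partition_boundary partition \<and>
    real (card S) = real (N - k0) * l ^ N \<and> (\<forall>p\<in>S. \<forall>q\<in>S. p \<noteq> q \<longrightarrow> e / l ^ N \<le> dist p q)" for N
  proof -
    define I where "I = Sigma {k0..<N} (\<lambda>k. {..<b ^ k} \<times> {..<b ^ (N - k)})"
    define Y where "Y k j = (b * j + 1) * b ^ (N - Suc k)" for k j :: nat
    define y where "y k j = real (Y k j) / l ^ N" for k j
    define x where "x k j s = u (y k j) + real s / l ^ (N - k) * (r (y k j) - u (y k j))" for k j s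
    define P where "P = (\<lambda>(k, j, s). proj (x k j s, y k j))"
    have y_eq: "l ^ Suc k * y k j = b * j + 1" if "k < N" for k j
    proof -
      have "l ^ N = l ^ Suc k * l ^ (N - Suc k)" using that by (simp add: power_add[symmetric] del: power_Suc)
      then show ?thesis using lpos by (simp add: y_def Y_def b add_divide_distrib distrib_right distrib_left)
    qed
    have jump: "\<bar>r (y k j) - u (y k j)\<bar> = J / l ^ Suc k" if "k < N" for k j
    proof -
      have pm: "lam ^ i * t \<in> \<int> \<longleftrightarrow> l ^ i * t \<in> \<int>" for i t
      proof -
        have "l ^ i * t = lam ^ i * t \<or> l ^ i * t = - (lam ^ i * t)"
          by (metis abs_if minus_mult_left power_abs)
        then show ?thesis by (metis Ints_minus add.inverse_inverse)
      qed
      have "\<exists>a b. (saw \<longlongrightarrow> a) (at_right (y k j)) \<and> (saw \<longlongrightarrow> b) (at_left (y k j)) \<and>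
          \<bar>a - b\<bar> = \<bar>m\<bar> / (l - 1) / l ^ Suc k"
      proof (rule saw_jump)
        show "lam ^ Suc k * y k j \<in> \<int>" unfolding pm y_eq[OF that] by (metis Ints_of_nat)
        show "lam ^ i * y k j \<notin> \<int>" if i: "i < Suc k" for i
        proof
          assume "lam ^ i * y k j \<in> \<int>"
          then obtain z where z: "l ^ i * y k j = of_int z" unfolding pm by (auto elim: Ints_cases)
          have "l ^ Suc k = l ^ i * l ^ Suc (k - i)" using i by (simp add: power_add[symmetric] del: power_Suc)
          then have "real (b * j + 1) = l ^ Suc (k - i) * of_int z"
            using y_eq[OF \<open>k < N\<close>, of j] unfolding z[symmetric] by (simp only: ac_simps)
          also have "\<dots> = of_int (int b ^ Suc (k - i) * z)" by (simp add: b)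
          finally have "int b * int j + 1 = int b * (int b ^ (k - i) * z)"
            by (metis (mono_tags, lifting) mult.assoc of_int_eq_iff of_int_of_nat_eq of_nat_1 of_nat_add of_nat_mult power_Suc)
          then have "int b dvd 1" by (metis dvd_add_right_iff dvd_triv_left)
          then show False using b by simp
        qed
      qed
      then obtain a1 b1 where ab: "(saw \<longlongrightarrow> a1) (at_right (y k j))" "(saw \<longlongrightarrow> b1) (at_left (y k j))"
        "\<bar>a1 - b1\<bar> = \<bar>m\<bar> / (l - 1) / l ^ Suc k" by blast
      have "a1 = r (y k j)" "b1 = u (y k j)"
        using tendsto_unique[OF _ ab(1) ru(1)] tendsto_unique[OF _ ab(2) ru(2)] by auto
      then show ?thesis using ab(3) by (simp add: J_def)
    qed
    have P_boundary: "P ` I \<subseteq> partition_boundary partition"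
    proof clarify
      fix k j s assume "(k, j, s) \<in> I"
      then have k: "k0 \<le> k" "k < N" and s: "s < b ^ (N - k)" by (auto simp: I_def)
      have "real s \<le> real (b ^ (N - k))" using s by linarith
      then have "real s \<le> l ^ (N - k)" by (simp add: b)
      then have "real s / l ^ (N - k) \<le> 1" using lpos by simp
      then show "P (k, j, s) \<in> partition_boundary partition"
        unfolding P_def x_def prod.case using k0[OF k(1)] lpos
        by (intro jump_segment_in_boundary[OF ru]) (simp_all add: jump[OF k(2)])
    qed
    have Y_less: "Y k j < b ^ N" if "k < N" "j < b ^ k" for k j
    proof -
      have "b * j + 1 < b * (j + 1)" using b by simp
      also have "\<dots> \<le> b * b ^ k" using that by (intro mult_le_mono) auto
      finally have "b * j + 1 < b ^ Suc k" by simp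
      then have "Y k j < b ^ Suc k * b ^ (N - Suc k)"
        unfolding Y_def using b by (intro mult_strict_right_mono) auto
      also have "\<dots> = b ^ N" using that by (simp add: power_add[symmetric] del: power_Suc)
      finally show ?thesis .
    qed
    \<comment> \<open>Otherwise \<open>b\<close> would divide \<open>b j' + 1\<close>: the order of an adic height is determined by its value.\<close>
    have Y_val: "k \<ge> k'" if "Y k j = Y k' j'" "k < N" "k' < N" for k j k' j'
    proof (rule ccontr)
      assume "\<not> k \<ge> k'"
      then have "N - Suc k = Suc (k' - k - 1) + (N - Suc k')" using that by simp
      then have "(b * j + 1) * b ^ Suc (k' - k - 1) * b ^ (N - Suc k') = (b * j' + 1) * b ^ (N - Suc k')"
        using that(1) unfolding Y_def by (simp only: power_add mult.assoc)
      then have "(b * j + 1) * b ^ Suc (k' - k - 1) = b * j' + 1"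
        unfolding mult_cancel2 using b by auto
      then have "b * ((b * j + 1) * b ^ (k' - k - 1)) = b * j' + 1" by (simp add: ac_simps)
      then have "b dvd 1" by (metis dvd_add_right_iff dvd_triv_left)
      then show False using b by simp
    qed
    have Y_inj: "k = k' \<and> j = j'" if "Y k j = Y k' j'" "k < N" "k' < N" for k j k' j'
    proof -
      have "k = k'" using Y_val[of k j k' j'] Y_val[of k' j' k j] that by simp
      then show ?thesis using that(1) b by (simp add: Y_def)
    qed
    have sep: "e / l ^ N \<le> dist (P p) (P q)" if "p \<in> I" "q \<in> I" "p \<noteq> q" for p q
    proof -
      obtain k j s k' j' s' where pq: "p = (k, j, s)" "q = (k', j', s')" by (metis surj_pair)
      have k: "k0 \<le> k" "k < N" "k < N" "j < b ^ k" "s < b ^ (N - k)"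
        and k': "k0 \<le> k'" "k' < N" "j' < b ^ k'" "s' < b ^ (N - k')"
        using that by (auto simp: I_def pq)
      obtain z w where zw: "z \<in> \<int>" "w \<in> \<int>"
        "c * max \<bar>x k j s - x k' j' s' - z\<bar> \<bar>y k j - y k' j' - w\<bar> \<le> dist (P p) (P q)"
        using proj_dist[of "x k j s" "x k' j' s'" "y k j" "y k' j'"] by (auto simp: P_def pq)
      show ?thesis
      proof (cases "k = k' \<and> j = j'")
        case False
        then have ne: "Y k j \<noteq> Y k' j'" using Y_inj k k' by blast
        obtain wi :: int where wi: "w = wi" using zw(2) by (auto elim: Ints_cases)
        define E where "E = int (Y k j) - int (Y k' j') - wi * int (b ^ N)"
        have "E \<noteq> 0"
        proof
          assume "E = 0"
          then have d: "int (Y k j) - int (Y k' j') = wi * int (b ^ N)" by (simp add: E_def)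
          have "\<bar>int (Y k j) - int (Y k' j')\<bar> < int (b ^ N)"
            using Y_less[of k j] Y_less[of k' j'] k k' by linarith
          then have "\<bar>wi\<bar> * int (b ^ N) < 1 * int (b ^ N)" unfolding d by (simp add: abs_mult)
          then have "wi = 0" using mult_right_less_imp_less[of "\<bar>wi\<bar>" "int (b ^ N)" 1] by fastforce
          then show False using d ne by simp
        qed
        then have "1 \<le> \<bar>real_of_int E\<bar>" by linarith
        moreover have "real_of_int E = l ^ N * (y k j - y k' j' - w)"
          using lpos by (simp add: E_def y_def wi right_diff_distrib b)
        ultimately have "1 \<le> l ^ N * \<bar>y k j - y k' j' - w\<bar>" using lpos by (simp add: abs_mult)
        then have "1 / l ^ N \<le> \<bar>y k j - y k' j' - w\<bar>" using lpos by (simp add: field_simps)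
        then have "1 / l ^ N \<le> max \<bar>x k j s - x k' j' s' - z\<bar> \<bar>y k j - y k' j' - w\<bar>" by simp
        then have "c * (1 / l ^ N) \<le> c * max \<bar>x k j s - x k' j' s' - z\<bar> \<bar>y k j - y k' j' - w\<bar>"
          using c_pos by (intro mult_left_mono) auto
        moreover have "e / l ^ N \<le> c * (1 / l ^ N)" using e(3) lpos by (simp add: divide_right_mono)
        ultimately show ?thesis using zw(3) by linarith
      next
        case True
        then have s: "s \<noteq> s'" using that pq by auto
        define h where "h = J / l ^ Suc N"
        define a where "a = (r (y k j) - u (y k j)) / l ^ (N - k)"
        have lN: "l ^ N = l ^ k * l ^ (N - k)" using k by (simp add: power_add[symmetric])
        have ah: "\<bar>a\<bar> = h" using jump[OF k(2)] lpos by (simp add: a_def h_def lN abs_divide)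
        have hpos: "0 < h" using J lpos by (simp add: h_def)
        have xd: "x k j s - x k' j' s' = (real s - real s') * a"
        proof -
          have "x k j s = u (y k j) + real s * a" "x k' j' s' = u (y k j) + real s' * a"
            using True by (simp_all add: x_def a_def)
          then show ?thesis by (simp add: left_diff_distrib)
        qed
        have dx: "\<bar>x k j s - x k' j' s'\<bar> = \<bar>real s - real s'\<bar> * h" unfolding xd abs_mult ah ..
        have "1 \<le> \<bar>real s - real s'\<bar>" using s by linarith
        then have low: "h \<le> \<bar>x k j s - x k' j' s'\<bar>" unfolding dx using hpos by simp
        have "s < b ^ (N - k)" "s' < b ^ (N - k)" using k(5) k'(4) True by simp_all
        then have "real s < real (b ^ (N - k))" "real s' < real (b ^ (N - k))"
          by (simp_all only: of_nat_less_iff)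
        then have "\<bar>real s - real s'\<bar> \<le> real (b ^ (N - k))" unfolding abs_le_iff
          by (simp only: of_nat_power) linarith
        then have "\<bar>x k j s - x k' j' s'\<bar> \<le> real (b ^ (N - k)) * h" unfolding dx using hpos by (intro mult_right_mono) auto
        also have "\<dots> = J / l ^ Suc k" using lpos by (simp add: b h_def lN)
        also have "\<dots> \<le> 1 / 2"
        proof -
          have "2 * (J / l ^ Suc k) \<le> L * (J / l ^ Suc k)"
            using L_ge2 J lpos by (intro mult_right_mono) auto
          then show ?thesis using k0[OF k(1)] by linarith
        qed
        finally have up: "\<bar>x k j s - x k' j' s'\<bar> \<le> 1 / 2" .
        have "h \<le> \<bar>x k j s - x k' j' s' - z\<bar>"
        proof (cases "z = 0")
          case False
          then have "1 \<le> \<bar>z\<bar>" using zw(1) Ints_nonzero_abs_ge1 by blast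
          then show ?thesis using low up by linarith
        qed (use low in simp)
        then have "h \<le> max \<bar>x k j s - x k' j' s' - z\<bar> \<bar>y k j - y k' j' - w\<bar>" by simp
        then have "c * h \<le> c * max \<bar>x k j s - x k' j' s' - z\<bar> \<bar>y k j - y k' j' - w\<bar>"
          using c_pos by (intro mult_left_mono) auto
        moreover have "e / l ^ N \<le> (c * (J / l)) / l ^ N" using e(4) lpos by (intro divide_right_mono) auto
        then have "e / l ^ N \<le> c * h" by (simp add: h_def)
        ultimately show ?thesis using zw(3) by linarith
      qed
    qed
    have inj: "inj_on P I"
    proof (rule inj_onI, rule ccontr)
      fix p q assume "p \<in> I" "q \<in> I" "P p = P q" "p \<noteq> q"
      then have "e / l ^ N \<le> 0" using sep[of p q] by simp
      moreover have "0 < e / l ^ N" using e lpos by simp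
      ultimately show False by linarith
    qed
    have "card I = (\<Sum>k\<in>{k0..<N}. b ^ k * b ^ (N - k))"
      unfolding I_def by (subst card_SigmaI) (auto simp: card_cartesian_product)
    also have "\<dots> = (\<Sum>k\<in>{k0..<N}. b ^ N)" by (intro sum.cong) (auto simp: power_add[symmetric])
    finally have "card (P ` I) = (N - k0) * b ^ N" using card_image[OF inj] by simp
    then have "real (card (P ` I)) = real (N - k0) * l ^ N" by (simp add: b)
    moreover have "finite (P ` I)" by (simp add: I_def)
    moreover have "\<forall>p\<in>P ` I. \<forall>q\<in>P ` I. p \<noteq> q \<longrightarrow> e / l ^ N \<le> dist p q"
      using sep by blast
    ultimately show ?thesis using P_boundary by blast
  qed
  then show ?thesis using e(1,2) by blast
qed

text \<open>
  A finite union of Lipschitz curves carries at most \<open>B / d\<close> points at mutual distance \<open>d\<close>. With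
  \<open>d = e / l^N\<close> this would bound \<open>N - k0\<close>.
\<close>
theorem boundary_not_Lipschitz:
  assumes "finite F" "partition_boundary partition = \<Union>F"
    and lip: "\<And>C. C \<in> F \<Longrightarrow> \<exists>g K. C = g ` {0..1::real} \<and> 0 < K \<and>
      (\<forall>s\<in>{0..1}. \<forall>t\<in>{0..1}. dist (g s) (g t) \<le> K * \<bar>s - t\<bar>)"
  shows False
proof -
  have lpos: "0 < l" using l_ge2 by simp
  obtain B where B: "\<forall>S (d::real). finite S \<and> S \<subseteq> \<Union>F \<and> 0 < d \<and> d \<le> 1 \<and>
      (\<forall>p\<in>S. \<forall>q\<in>S. p \<noteq> q \<longrightarrow> d \<le> dist p q) \<longrightarrow> real (card S) * d \<le> B"
    using separated_bound_Lipschitz_curves[OF assms(1) lip] ..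
  obtain e k0 where e: "0 < e" "e \<le> 1" and sep: "\<And>N. \<exists>S. finite S \<and> S \<subseteq> partition_boundary partition \<and>
    real (card S) = real (N - k0) * l ^ N \<and> (\<forall>p\<in>S. \<forall>q\<in>S. p \<noteq> q \<longrightarrow> e / l ^ N \<le> dist p q)"
    using separated_sets_in_boundary by auto
  have "real (N - k0) * e \<le> B" for N
  proof -
    obtain S where S: "finite S" "S \<subseteq> partition_boundary partition" "real (card S) = real (N - k0) * l ^ N"
      "\<forall>p\<in>S. \<forall>q\<in>S. p \<noteq> q \<longrightarrow> e / l ^ N \<le> dist p q" using sep[of N] by blast
    have "1 \<le> l ^ N" using l_ge2 by (intro one_le_power) simp
    then have "e / l ^ N \<le> 1 / 1" using e by (intro frac_le) auto
    then have "real (card S) * (e / l ^ N) \<le> B"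
      using S e lpos assms(2) by (intro B[rule_format]) auto
    then show ?thesis using lpos by (simp add: S(3))
  qed
  from this[of "k0 + nat \<lceil>B / e\<rceil> + 1"] have "real (nat \<lceil>B / e\<rceil> + 1) * e \<le> B" by simp
  moreover have "B / e < real (nat \<lceil>B / e\<rceil> + 1)" by linarith
  then have "B < real (nat \<lceil>B / e\<rceil> + 1) * e" using e by (simp add: field_simps)
  ultimately show False by linarith
qed

end

section \<open>Integer bases of non-diagonalizable matrices\<close>

text \<open>
  The discriminant vanishes, so \<open>a - d\<close> is even, the double eigenvalue is an integer, and the matrix
  minus the eigenvalue is a nilpotent matrix with rows \<open>(e, b)\<close> and \<open>(c, -e)\<close>. A primitive vector \<open>u\<close>
  in its kernel is completed to a basis of the lattice by Bezout coefficients; the nilpotent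
  matrix maps the second basis vector to a multiple of \<open>u\<close>.
\<close>
lemma integer_shear_basis:
  fixes a b c d :: int
  assumes disc: "(a - d)^2 + 4 * b * c = 0" and nonscalar: "\<not> (b = 0 \<and> c = 0)"
  obtains lam m u1 u2 v1 v2 :: int
  where "u1 * v2 - u2 * v1 = 1" "m \<noteq> 0"
    "a * u1 + b * u2 = lam * u1" "c * u1 + d * u2 = lam * u2"
    "a * v1 + b * v2 = lam * v1 + m * u1" "c * v1 + d * v2 = lam * v2 + m * u2"
proof -
  have "even ((a - d)^2)" using disc by (metis dvd_add_triv_right_iff dvd_0_right dvd_mult2 dvd_triv_left even_add even_mult_iff even_numeral)
  then have "even (a - d)" by simp
  then obtain e where e: "a - d = 2 * e" by (elim evenE)
  have ebc: "e * e + b * c = 0" using disc unfolding e by (simp add: power2_eq_square)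
  \<comment> \<open>If \<open>c = 0\<close>, then \<open>e = 0\<close> as well, and the kernel is spanned by \<open>(1, 0)\<close>.\<close>
  define p q where "p = (if c \<noteq> 0 then e else 1)" and "q = c"
  have pq: "e * p + b * q = 0" "c * p - e * q = 0" "\<not> (p = 0 \<and> q = 0)"
    using ebc by (auto simp: p_def q_def)
  define g where "g = gcd p q"
  have g: "g \<noteq> 0" using pq(3) by (auto simp: g_def)
  define u1 u2 where "u1 = p div g" and "u2 = q div g"
  have pu: "p = g * u1" "q = g * u2" by (simp_all add: u1_def u2_def g_def)
  have "gcd u1 u2 = 1" unfolding u1_def u2_def g_def using pq(3) by (intro div_gcd_coprime[unfolded coprime_iff_gcd_eq_1]) auto
  then obtain x y where xy: "x * u1 + y * u2 = 1" using bezout_int[of u1 u2] by auto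
  have "g * (e * u1 + b * u2) = 0" "g * (c * u1 - e * u2) = 0"
    using pq(1,2) unfolding pu by algebra+
  then have Nu: "e * u1 + b * u2 = 0" "c * u1 - e * u2 = 0" using g by simp_all
  define v1 v2 where "v1 = - y" and "v2 = x"
  have dt: "u1 * v2 - u2 * v1 = 1" using xy by (simp add: v1_def v2_def algebra_simps)
  define m where "m = (e * v1 + b * v2) * v2 - (c * v1 - e * v2) * v1"
  have Nv: "e * v1 + b * v2 = m * u1" "c * v1 - e * v2 = m * u2"
    using Nu dt unfolding m_def by algebra+
  have "m \<noteq> 0"
  proof
    assume "m = 0"
    then have "e * v1 + b * v2 = 0" "c * v1 - e * v2 = 0" using Nv by simp_all
    then have "b = 0" "c = 0" using Nu dt by algebra+
    then show False using nonscalar by simp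
  qed
  moreover have "a * u1 + b * u2 = (d + e) * u1" "c * u1 + d * u2 = (d + e) * u2"
    "a * v1 + b * v2 = (d + e) * v1 + m * u1" "c * v1 + d * v2 = (d + e) * v2 + m * u2"
    using Nu Nv e by algebra+
  ultimately show thesis using dt that by blast
qed

lemma diagonalizable_over_complexI:
  fixes A :: "int ^ 2 ^ 2" and P D :: "complex ^ 2 ^ 2"
  assumes "invertible P" "map_matrix of_int A ** P = P ** D" "D $ 1 $ 2 = 0" "D $ 2 $ 1 = 0"
  shows "diagonalizable_over_complex A"
proof -
  have inv: "matrix_inv P ** P = mat 1"
    using someI_ex[OF assms(1)[unfolded invertible_def]] by (simp add: matrix_inv_def)
  have "matrix_inv P ** map_matrix of_int A ** P = matrix_inv P ** (P ** D)"
    using assms(2) by (simp add: matrix_mul_assoc[symmetric])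
  also have "\<dots> = D" by (simp add: matrix_mul_assoc inv)
  finally have eq: "matrix_inv P ** map_matrix of_int A ** P = D" .
  have "\<forall>i j. i \<noteq> j \<longrightarrow> D $ i $ j = 0" using assms(3,4) by (auto simp: forall_2)
  then show ?thesis unfolding diagonalizable_over_complex_def using assms(1) eq by metis
qed

lemma matrix2_eqI:
  fixes P Q :: "'a ^ 2 ^ 2"
  assumes "P $ 1 $ 1 = Q $ 1 $ 1" "P $ 1 $ 2 = Q $ 1 $ 2" "P $ 2 $ 1 = Q $ 2 $ 1" "P $ 2 $ 2 = Q $ 2 $ 2"
  shows "P = Q"
  using assms by (simp add: vec_eq_iff forall_2)

text \<open>
  The columns of the conjugating matrix are eigenvectors for the two distinct eigenvalues. Their
  first or second coordinates can be chosen as an off-diagonal entry, provided that this entry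
  does not vanish; if both off-diagonal entries do, the matrix is diagonal.
\<close>
lemma diagonalizable_if_disc_nonzero:
  fixes A :: "int ^ 2 ^ 2"
  assumes "(A $ 1 $ 1 - A $ 2 $ 2)^2 + 4 * A $ 1 $ 2 * A $ 2 $ 1 \<noteq> 0"
  shows "diagonalizable_over_complex A"
proof -
  define a b c d :: complex where abcd: "a = of_int (A $ 1 $ 1)" "b = of_int (A $ 1 $ 2)"
    "c = of_int (A $ 2 $ 1)" "d = of_int (A $ 2 $ 2)"
  define s where "s = csqrt ((a - d)^2 + 4 * b * c)"
  have s2: "s * s = (a - d)^2 + 4 * b * c" by (simp add: s_def power2_eq_square[symmetric])
  have "(a - d)^2 + 4 * b * c = of_int ((A $ 1 $ 1 - A $ 2 $ 2)^2 + 4 * A $ 1 $ 2 * A $ 2 $ 1)"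
    by (simp add: abcd)
  then have "(a - d)^2 + 4 * b * c \<noteq> 0" using assms by (metis of_int_eq_0_iff)
  then have s0: "s \<noteq> 0" using s2 by auto
  define p q where "p = (a + d + s) / 2" "q = (a + d - s) / 2"
  have pq: "p * p = (a + d) * p - a * d + b * c" "q * q = (a + d) * q - a * d + b * c"
  proof -
    have "2 * p = a + d + s" "2 * q = a + d - s" by (simp_all add: p_q_def)
    then have "4 * (p * p) = 4 * ((a + d) * p - a * d + b * c)" "4 * (q * q) = 4 * ((a + d) * q - a * d + b * c)"
      using s2 by algebra+
    then show "p * p = (a + d) * p - a * d + b * c" "q * q = (a + d) * q - a * d + b * c"
      by (metis mult_cancel_left zero_neq_numeral)+
  qed
  have pmq: "p - q = s" by (simp add: p_q_def field_simps)
  define D :: "complex ^ 2 ^ 2" where "D = vector [vector [p, 0], vector [0, q]]"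
  have D: "D $ 1 $ 2 = 0" "D $ 2 $ 1 = 0" by (simp_all add: D_def)
  consider "b \<noteq> 0" | "c \<noteq> 0" | "b = 0" "c = 0" by blast
  then show ?thesis
  proof cases
    case 1
    define P :: "complex ^ 2 ^ 2" where "P = vector [vector [b, b], vector [p - a, q - a]]"
    have "det P = - b * (p - q)" by (simp add: P_def det_2 algebra_simps)
    then have inv: "invertible P" using 1 s0 pmq by (simp add: invertible_det_nz)
    have "map_matrix of_int A ** P = P ** D"
      by (rule matrix2_eqI)
        (simp_all add: P_def D_def matrix_matrix_mult_def sum_2 map_matrix_def abcd[symmetric] algebra_simps pq)
    then show ?thesis using diagonalizable_over_complexI[OF inv _ D] by simp
  next
    case 2
    define P :: "complex ^ 2 ^ 2" where "P = vector [vector [p - d, q - d], vector [c, c]]"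
    have "det P = c * (p - q)" by (simp add: P_def det_2 algebra_simps)
    then have inv: "invertible P" using 2 s0 pmq by (simp add: invertible_det_nz)
    have "map_matrix of_int A ** P = P ** D"
      by (rule matrix2_eqI)
        (simp_all add: P_def D_def matrix_matrix_mult_def sum_2 map_matrix_def abcd[symmetric] algebra_simps pq)
    then show ?thesis using diagonalizable_over_complexI[OF inv _ D] by simp
  next
    case 3
    show ?thesis
      by (rule diagonalizable_over_complexI[of "mat 1" _ "map_matrix of_int A"])
        (use 3 in \<open>simp_all add: map_matrix_def abcd invertible_det_nz\<close>)
  qed
qed

lemma nondiagonalizable_shear_basis:
  fixes A :: "int ^ 2 ^ 2"
  assumes "expanding_matrix A" "\<not> diagonalizable_over_complex A"
  obtains lam m u1 u2 v1 v2 :: int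
  where "2 \<le> \<bar>lam\<bar>" "m \<noteq> 0" "u1 * v2 - u2 * v1 = 1"
    "A $ 1 $ 1 * u1 + A $ 1 $ 2 * u2 = lam * u1" "A $ 2 $ 1 * u1 + A $ 2 $ 2 * u2 = lam * u2"
    "A $ 1 $ 1 * v1 + A $ 1 $ 2 * v2 = lam * v1 + m * u1" "A $ 2 $ 1 * v1 + A $ 2 $ 2 * v2 = lam * v2 + m * u2"
proof -
  have disc: "(A $ 1 $ 1 - A $ 2 $ 2)^2 + 4 * A $ 1 $ 2 * A $ 2 $ 1 = 0"
    using diagonalizable_if_disc_nonzero assms(2) by blast
  have "\<not> (A $ 1 $ 2 = 0 \<and> A $ 2 $ 1 = 0)"
  proof
    assume z: "A $ 1 $ 2 = 0 \<and> A $ 2 $ 1 = 0"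
    have "diagonalizable_over_complex A"
      by (rule diagonalizable_over_complexI[of "mat 1" _ "map_matrix of_int A"])
        (use z in \<open>simp_all add: map_matrix_def invertible_det_nz\<close>)
    then show False using assms(2) by simp
  qed
  from integer_shear_basis[OF disc this] obtain lam m u1 u2 v1 v2 where b:
    "u1 * v2 - u2 * v1 = 1" "m \<noteq> 0"
    "A $ 1 $ 1 * u1 + A $ 1 $ 2 * u2 = lam * u1" "A $ 2 $ 1 * u1 + A $ 2 $ 2 * u2 = lam * u2"
    "A $ 1 $ 1 * v1 + A $ 1 $ 2 * v2 = lam * v1 + m * u1" "A $ 2 $ 1 * v1 + A $ 2 $ 2 * v2 = lam * v2 + m * u2" .
  define w :: "complex ^ 2" where "w = vector [of_int u1, of_int u2]"
  have "w \<noteq> 0"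
    using b(1) by (auto simp: w_def vec_eq_iff forall_2)
  moreover have "map_matrix of_int A *v w = of_int lam *s w"
  proof -
    have "of_int (A $ 1 $ 1) * of_int u1 + of_int (A $ 1 $ 2) * of_int u2 = (of_int lam * of_int u1 :: complex)"
      "of_int (A $ 2 $ 1) * of_int u1 + of_int (A $ 2 $ 2) * of_int u2 = (of_int lam * of_int u2 :: complex)"
      by (simp_all only: of_int_mult[symmetric] of_int_add[symmetric] b)
    then show ?thesis
      by (simp add: vec_eq_iff forall_2 matrix_vector_mult_def sum_2 w_def map_matrix_def)
  qed
  ultimately have "cmod (of_int lam) > 1" using assms(1) unfolding expanding_matrix_def by blast
  then have "2 \<le> \<bar>lam\<bar>" by simp
  then show thesis using that b by blast
qed

section \<open>The torus in an integer basis\<close>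

lemma dist_torus_proj_le: "dist (torus_proj p) (torus_proj q) \<le> dist p q"
  using infdist_le[OF int_lattice_0, of "p - q"] by (simp add: dist_torus.abs_eq dist_norm)

lemma continuous_torus_proj: "continuous_on UNIV torus_proj"
  by (rule continuous_on_iff[THEN iffD2]) (meson dist_torus_proj_le le_less_trans)

lemma torus_proj_eq_iff: "torus_proj p = torus_proj q \<longleftrightarrow> p - q \<in> int_lattice"
  by (rule torus.abs_eq_iff)

lemma surj_torus_proj: "surj torus_proj"
  by (metis Quotient_abs_rep Quotient_torus surjI)

text \<open>
  The distance to the closed lattice is attained, so a torus point near \<open>torus_proj p\<close> has a
  representative near \<open>p\<close>.
\<close>
lemma open_torus_proj_image:
  assumes "open S" shows "open (torus_proj ` S)"
  unfolding open_dist
proof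
  fix t assume "t \<in> torus_proj ` S"
  then obtain p where p: "p \<in> S" "t = torus_proj p" by blast
  obtain e where e: "e > 0" "ball p e \<subseteq> S" using assms p(1) open_contains_ball by blast
  have "s \<in> torus_proj ` S" if "dist s t < e" for s
  proof -
    obtain q where q: "s = torus_proj q" using surj_torus_proj by blast
    obtain z where z: "z \<in> int_lattice" "infdist (p - q) int_lattice = dist (p - q) z"
      using infdist_attains_inf[OF closed_int_lattice int_lattice_nonempty] by blast
    have "dist p (q + z) < e"
      using that z by (simp add: q p(2) dist_commute dist_torus.abs_eq) (simp add: dist_norm algebra_simps norm_minus_commute[of p])
    then have "q + z \<in> S" using e by auto
    moreover have "s = torus_proj (q + z)"
      unfolding q torus_proj_eq_iff using int_lattice_minus[OF z(1)] by simp
    ultimately show ?thesis by blast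
  qed
  then show "\<exists>e>0. \<forall>s. dist s t < e \<longrightarrow> s \<in> torus_proj ` S" using e(1) by blast
qed

text \<open>
  The derivative is bounded by compactness, and \<open>torus_proj\<close> does not increase distances; so near
  every parameter \<open>t\<close> the distance from \<open>g t\<close> grows at most with slope \<open>M + 1\<close>. Estimates of this kind
  on adjacent intervals add up.
\<close>
lemma C1_arc_Lipschitz:
  assumes "C1_arc C"
  shows "\<exists>g K. C = g ` {0..1::real} \<and> 0 < K \<and> (\<forall>s\<in>{0..1}. \<forall>t\<in>{0..1}. dist (g s) (g t) \<le> K * \<bar>s - t\<bar>)"
proof -
  obtain g g' where C: "C = g ` {0..1}" and g': "continuous_on {0..1} g'"
    and der: "\<And>t. t \<in> {0..1} \<Longrightarrow> torus_has_derivative g (g' t) t {0..1}"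
    using assms unfolding C1_arc_def by blast
  have "bounded (g' ` {0..1})" using g' by (intro compact_imp_bounded compact_continuous_image) auto
  then obtain M where M: "0 < M" "\<And>t. t \<in> {0..1} \<Longrightarrow> norm (g' t) \<le> M"
    unfolding bounded_pos by auto
  define K where "K = M + 1"
  have loc: "\<exists>d>0. \<forall>s\<in>{0..1}. \<bar>s - t\<bar> < d \<longrightarrow> dist (g s) (g t) \<le> K * \<bar>s - t\<bar>" if t: "t \<in> {0..1}" for t
  proof -
    obtain h where h: "g t = torus_proj (h t)" "\<forall>\<^sub>F s in at t within {0..1}. g s = torus_proj (h s)"
      "(h has_vector_derivative g' t) (at t within {0..1})"
      using der[OF t] unfolding torus_has_derivative_def by blast
    have "\<forall>\<^sub>F s in at t within {0..1}. norm (h s - h t - (s - t) *\<^sub>R g' t) \<le> 1 * norm (s - t)"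
      using h(3)[unfolded has_vector_derivative_def has_derivative_within_alt2, THEN conjunct2, rule_format, of 1]
      by simp
    with h(2) have "\<forall>\<^sub>F s in at t within {0..1}. dist (g s) (g t) \<le> K * \<bar>s - t\<bar>"
    proof eventually_elim
      case (elim s)
      have "norm (h s - h t) \<le> norm (h s - h t - (s - t) *\<^sub>R g' t) + norm ((s - t) *\<^sub>R g' t)"
        by (metis diff_add_cancel norm_triangle_ineq)
      also have "\<dots> \<le> \<bar>s - t\<bar> + \<bar>s - t\<bar> * M"
        using elim(2) M(2)[OF t] by (intro add_mono) (auto intro: mult_left_mono)
      finally have "dist (h s) (h t) \<le> K * \<bar>s - t\<bar>" by (simp add: dist_norm K_def algebra_simps)
      then show ?case using dist_torus_proj_le[of "h s" "h t"] elim(1) h(1) by simp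
    qed
    then obtain d where d: "d > 0" "\<And>s. s \<in> {0..1} \<Longrightarrow> s \<noteq> t \<Longrightarrow> \<bar>s - t\<bar> < d \<Longrightarrow> dist (g s) (g t) \<le> K * \<bar>s - t\<bar>"
      unfolding eventually_at dist_real_def by blast
    have "dist (g s) (g t) \<le> K * \<bar>s - t\<bar>" if "s \<in> {0..1}" "\<bar>s - t\<bar> < d" for s
      using d(2)[of s] that by (cases "s = t") auto
    then show ?thesis using d(1) by blast
  qed
  have "dist (g s) (g t) \<le> K * (t - s)" if "s \<le> t" "0 \<le> s" "t \<le> 1" for s t
  proof -
    have "0 \<le> s \<and> t \<le> 1 \<longrightarrow> dist (g s) (g t) \<le> K * (t - s)"
      using that(1)
    proof (induction rule: Bolzano)
      case (trans a b c)
      show ?case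
      proof
        assume "0 \<le> a \<and> c \<le> 1"
        then have "dist (g a) (g b) \<le> K * (b - a)" "dist (g b) (g c) \<le> K * (c - b)" using trans by auto
        then have "dist (g a) (g c) \<le> K * (b - a) + K * (c - b)" using dist_triangle[of "g a" "g c" "g b"] by linarith
        then show "dist (g a) (g c) \<le> K * (c - a)" by (simp add: algebra_simps)
      qed
    next
      case (local x)
      then have "x \<in> {0..1}" using that by auto
      from loc[OF this] obtain d where d: "d > 0" "\<And>s. s \<in> {0..1} \<Longrightarrow> \<bar>s - x\<bar> < d \<Longrightarrow> dist (g s) (g x) \<le> K * \<bar>s - x\<bar>"
        by blast
      show ?case
      proof (intro exI[of _ d] conjI allI impI d(1))
        fix a b assume ab: "a \<le> x \<and> x \<le> b \<and> b - a < d" "0 \<le> a \<and> b \<le> 1"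
        have "dist (g a) (g x) \<le> K * (x - a)" "dist (g b) (g x) \<le> K * (b - x)"
          using d(2)[of a] d(2)[of b] ab by auto
        then have "dist (g a) (g b) \<le> K * (x - a) + K * (b - x)"
          using dist_triangle2[of "g a" "g b" "g x"] by linarith
        then show "dist (g a) (g b) \<le> K * (b - a)" by (simp add: algebra_simps)
      qed
    qed
    then show ?thesis using that by simp
  qed note mono = this
  have "dist (g s) (g t) \<le> K * \<bar>s - t\<bar>" if "s \<in> {0..1}" "t \<in> {0..1}" for s t
    using mono[of s t] mono[of t s] that by (cases "s \<le> t") (auto simp: dist_commute)
  moreover have "0 < K" using M by (simp add: K_def)
  ultimately show ?thesis using C by blast
qed

text \<open>
  The torus seen in the coordinates of a basis \<open>(u1, u2)\<close>, \<open>(v1, v2)\<close> of the integer lattice. Working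
  in these coordinates replaces a conjugation of \<open>A\<close> by a matrix with integer inverse.
\<close>
locale unimodular_basis =
  fixes u1 u2 v1 v2 :: real
  assumes basis_Int: "u1 \<in> \<int>" "u2 \<in> \<int>" "v1 \<in> \<int>" "v2 \<in> \<int>"
    and det1: "u1 * v2 - u2 * v1 = 1"
begin

definition lin :: "real \<times> real \<Rightarrow> real ^ 2" where
  "lin = (\<lambda>(x, y). vector [x * u1 + y * v1, x * u2 + y * v2])"

definition proj :: "real \<times> real \<Rightarrow> 2 torus" where
  "proj p = torus_proj (lin p)"

lemma lin_nth [simp]: "lin (x, y) $ 1 = x * u1 + y * v1" "lin (x, y) $ 2 = x * u2 + y * v2"
  by (simp_all add: lin_def)

definition coords :: "real ^ 2 \<Rightarrow> real \<times> real" where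
  "coords w = (v2 * w $ 1 - v1 * w $ 2, u1 * w $ 2 - u2 * w $ 1)"

lemma coords_lin [simp]: "coords (lin p) = p"
proof (cases p)
  case (Pair x y)
  have "v2 * (x * u1 + y * v1) - v1 * (x * u2 + y * v2) = x * (u1 * v2 - u2 * v1)"
    "u1 * (x * u2 + y * v2) - u2 * (x * u1 + y * v1) = y * (u1 * v2 - u2 * v1)"
    by (simp_all add: algebra_simps)
  then show ?thesis unfolding Pair coords_def lin_nth det1 by simp
qed

lemma lin_coords [simp]: "lin (coords w) = w"
proof -
  have "(v2 * w $ 1 - v1 * w $ 2) * u1 + (u1 * w $ 2 - u2 * w $ 1) * v1 = w $ 1 * (u1 * v2 - u2 * v1)"
    "(v2 * w $ 1 - v1 * w $ 2) * u2 + (u1 * w $ 2 - u2 * w $ 1) * v2 = w $ 2 * (u1 * v2 - u2 * v1)"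
    by (simp_all add: algebra_simps)
  then show ?thesis unfolding coords_def vec_eq_iff forall_2 lin_nth det1 by simp
qed

lemma lin_diff: "lin (x, y) - lin (x', y') = lin (x - x', y - y')"
  by (simp add: vec_eq_iff forall_2 algebra_simps)

lemma continuous_lin: "continuous_on S lin"
proof -
  have "lin = (\<lambda>p. \<chi> i. if i = 1 then fst p * u1 + snd p * v1 else fst p * u2 + snd p * v2)"
    by (auto simp: fun_eq_iff vec_eq_iff forall_2)
  moreover have "continuous_on S (\<lambda>p. (\<chi> i. if i = 1 then fst p * u1 + snd p * v1 else fst p * u2 + snd p * v2) :: real ^ 2)"
  proof (rule continuous_on_vec_lambda)
    show "continuous_on S (\<lambda>p. if i = 1 then fst p * u1 + snd p * v1 else fst p * u2 + snd p * v2)" for i :: 2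
      by (cases "i = 1") (auto intro!: continuous_intros)
  qed
  ultimately show ?thesis by simp
qed

lemma lin_in_lattice: "lin (x, y) \<in> int_lattice \<longleftrightarrow> x \<in> \<int> \<and> y \<in> \<int>"
proof
  assume "x \<in> \<int> \<and> y \<in> \<int>"
  then show "lin (x, y) \<in> int_lattice" using basis_Int by (auto simp: int_lattice_def forall_2)
next
  assume "lin (x, y) \<in> int_lattice"
  then have "lin (x, y) $ 1 \<in> \<int>" "lin (x, y) $ 2 \<in> \<int>" unfolding int_lattice_def by blast+
  then have "v2 * lin (x, y) $ 1 - v1 * lin (x, y) $ 2 \<in> \<int>" "u1 * lin (x, y) $ 2 - u2 * lin (x, y) $ 1 \<in> \<int>"
    using basis_Int by (auto simp del: lin_nth)
  then show "x \<in> \<int> \<and> y \<in> \<int>" using coords_lin[of "(x, y)"] by (simp add: coords_def del: lin_nth coords_lin)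
qed

lemma proj_eq: "proj (x, y) = proj (x', y') \<longleftrightarrow> x - x' \<in> \<int> \<and> y - y' \<in> \<int>"
  unfolding proj_def torus_proj_eq_iff lin_diff lin_in_lattice ..

lemma continuous_proj: "continuous_on UNIV proj"
  unfolding proj_def
  by (rule continuous_on_compose2[OF continuous_torus_proj continuous_lin]) auto

lemma surj_proj: "range proj = UNIV"
  by (metis proj_def lin_coords surj_def surj_torus_proj)

lemma open_proj_image: assumes "open S" shows "open (proj ` S)"
proof -
  have "lin ` S = coords -` S"
  proof (rule set_eqI)
    show "w \<in> lin ` S \<longleftrightarrow> w \<in> coords -` S" for w
      using image_eqI[of w lin "coords w" S] by auto
  qed
  moreover have "continuous_on UNIV coords" unfolding coords_def by (intro continuous_intros)
  ultimately have "open (lin ` S)" using open_vimage[OF assms, of coords] by simp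
  then show ?thesis using open_torus_proj_image[of "lin ` S"] by (simp add: proj_def image_image)
qed

text \<open>
  A lower bound for the stretching of lengths by \<open>lin\<close>, read off from the entries of its inverse.
\<close>
definition distortion :: real where
  "distortion = 1 / (1 + \<bar>u1\<bar> + \<bar>u2\<bar> + \<bar>v1\<bar> + \<bar>v2\<bar>)"

lemma distortion_pos: "0 < distortion"
  by (simp add: distortion_def add_pos_nonneg)

lemma norm_lin: "distortion * max \<bar>x\<bar> \<bar>y\<bar> \<le> norm (lin (x, y))"
proof -
  define w where "w = lin (x, y)"
  have w: "\<bar>w $ 1\<bar> \<le> norm w" "\<bar>w $ 2\<bar> \<le> norm w" by (rule component_le_norm_cart)+
  have le: "\<bar>a * w $ 1 - b * w $ 2\<bar> \<le> (\<bar>a\<bar> + \<bar>b\<bar>) * norm w"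
    "\<bar>a * w $ 2 - b * w $ 1\<bar> \<le> (\<bar>a\<bar> + \<bar>b\<bar>) * norm w" for a b :: real
  proof -
    have "\<bar>a * w $ i\<bar> \<le> \<bar>a\<bar> * norm w" "\<bar>b * w $ i\<bar> \<le> \<bar>b\<bar> * norm w" for i
      unfolding abs_mult by (intro mult_left_mono component_le_norm_cart; simp)+
    from this[of 1] this[of 2]
    show "\<bar>a * w $ 1 - b * w $ 2\<bar> \<le> (\<bar>a\<bar> + \<bar>b\<bar>) * norm w"
      "\<bar>a * w $ 2 - b * w $ 1\<bar> \<le> (\<bar>a\<bar> + \<bar>b\<bar>) * norm w"
      unfolding distrib_right by linarith+
  qed
  define T where "T = 1 + \<bar>u1\<bar> + \<bar>u2\<bar> + \<bar>v1\<bar> + \<bar>v2\<bar>"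
  have xy: "x = v2 * w $ 1 - v1 * w $ 2" "y = u1 * w $ 2 - u2 * w $ 1"
    using coords_lin[of "(x, y)"] unfolding w_def[symmetric] coords_def by simp_all
  have "\<bar>x\<bar> \<le> (\<bar>v2\<bar> + \<bar>v1\<bar>) * norm w" "\<bar>y\<bar> \<le> (\<bar>u1\<bar> + \<bar>u2\<bar>) * norm w"
    using le(1)[of v2 v1] le(2)[of u1 u2] unfolding xy[symmetric] by simp_all
  moreover have "(\<bar>v2\<bar> + \<bar>v1\<bar>) * norm w \<le> T * norm w" "(\<bar>u1\<bar> + \<bar>u2\<bar>) * norm w \<le> T * norm w"
    by (intro mult_right_mono; simp add: T_def)+
  ultimately have "max \<bar>x\<bar> \<bar>y\<bar> \<le> T * norm w" by simp
  moreover have "0 < T" by (simp add: T_def add_pos_nonneg)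
  moreover have "distortion = 1 / T" by (simp add: distortion_def T_def)
  ultimately show ?thesis unfolding w_def[symmetric] by (simp add: pos_divide_le_eq mult.commute del: max.bounded_iff)
qed

lemma dist_proj_ge:
  "\<exists>a\<in>\<int>. \<exists>b\<in>\<int>. distortion * max \<bar>x - x' - a\<bar> \<bar>y - y' - b\<bar> \<le> dist (proj (x, y)) (proj (x', y'))"
proof -
  obtain z where z: "z \<in> int_lattice" "infdist (lin (x, y) - lin (x', y')) int_lattice = dist (lin (x, y) - lin (x', y')) z"
    using infdist_attains_inf[OF closed_int_lattice int_lattice_nonempty] by blast
  obtain a b where ab: "coords z = (a, b)" by force
  then have zab: "z = lin (a, b)" by (metis lin_coords)
  then have "a \<in> \<int>" "b \<in> \<int>" using z(1) by (simp_all add: lin_in_lattice)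
  moreover have "dist (proj (x, y)) (proj (x', y')) = norm (lin (x - x' - a, y - y' - b))"
    using z(2) by (simp add: proj_def dist_torus.abs_eq dist_norm zab lin_diff)
  ultimately show ?thesis using norm_lin[of "x - x' - a" "y - y' - b"] by auto
qed

lemma horizontal_C1_arc: "C1_arc ((\<lambda>t. proj (t / 2, 0)) ` {0..1})"
proof -
  define w where "w = lin (1 / 2, 0)"
  have g: "proj (t / 2, 0) = torus_proj (t *\<^sub>R w)" for t
  proof -
    have "lin (t / 2, 0) = t *\<^sub>R w" by (simp add: w_def vec_eq_iff forall_2)
    then show ?thesis by (simp add: proj_def)
  qed
  have "w \<noteq> 0"
  proof
    assume "w = 0"
    then have "coords w = (0, 0)" by (simp add: coords_def)
    then show False by (simp add: w_def)
  qed
  moreover have "torus_has_derivative (\<lambda>t. proj (t / 2, 0)) w t {0..1}" for t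
    unfolding torus_has_derivative_def g
    by (intro exI[of _ "\<lambda>s. s *\<^sub>R w"]) (auto intro!: derivative_eq_intros)
  moreover have "inj_on (\<lambda>t. proj (t / 2, 0)) {0..1}"
  proof (rule inj_onI)
    fix s t :: real assume st: "s \<in> {0..1}" "t \<in> {0..1}" "proj (s / 2, 0) = proj (t / 2, 0)"
    then have "s / 2 - t / 2 \<in> \<int>" by (simp add: proj_eq)
    moreover have "\<bar>s / 2 - t / 2\<bar> < 1" using st by auto
    ultimately have "s / 2 - t / 2 = 0" using Ints_nonzero_abs_less1 by blast
    then show "s = t" by simp
  qed
  ultimately show ?thesis unfolding C1_arc_def
    by (intro exI[of _ "\<lambda>t. proj (t / 2, 0)"] exI[of _ "\<lambda>_. w"]) auto
qed

end

lemma toral_endo_proj: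
  fixes A :: "int ^ 2 ^ 2" and lam m u1 u2 v1 v2 :: int and x y :: real
  assumes "unimodular_basis (of_int u1) (of_int u2) (of_int v1) (of_int v2)"
    and "A $ 1 $ 1 * u1 + A $ 1 $ 2 * u2 = lam * u1" "A $ 2 $ 1 * u1 + A $ 2 $ 2 * u2 = lam * u2"
    "A $ 1 $ 1 * v1 + A $ 1 $ 2 * v2 = lam * v1 + m * u1" "A $ 2 $ 1 * v1 + A $ 2 $ 2 * v2 = lam * v2 + m * u2"
  shows "toral_endo A (unimodular_basis.proj (of_int u1) (of_int u2) (of_int v1) (of_int v2) (x, y)) =
    unimodular_basis.proj (of_int u1) (of_int u2) (of_int v1) (of_int v2) (lam * x + m * y, lam * y)"
proof -
  interpret unimodular_basis "of_int u1" "of_int u2" "of_int v1" "of_int v2" by (rule assms)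
  let ?a = "\<lambda>i j. real_of_int (A $ i $ j)"
  have r: "?a 1 1 * of_int u1 + ?a 1 2 * of_int u2 = of_int lam * of_int u1"
    "?a 2 1 * of_int u1 + ?a 2 2 * of_int u2 = of_int lam * of_int u2"
    "?a 1 1 * of_int v1 + ?a 1 2 * of_int v2 = of_int lam * of_int v1 + of_int m * of_int u1"
    "?a 2 1 * of_int v1 + ?a 2 2 * of_int v2 = of_int lam * of_int v2 + of_int m * of_int u2"
    by (simp_all only: of_int_mult[symmetric] of_int_add[symmetric] assms)
  have lincomb: "p * (x * q + y * q') + s * (x * t + y * t') = (lam * x + m * y) * r + lam * y * r'"
    if "p * q + s * t = lam * r" "p * q' + s * t' = lam * r' + m * r" for p q q' s t t' r r' :: real
  proof -
    have "p * (x * q + y * q') + s * (x * t + y * t') = x * (p * q + s * t) + y * (p * q' + s * t')"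
      by (simp add: algebra_simps)
    then show ?thesis unfolding that by (simp add: algebra_simps)
  qed
  have "map_matrix real_of_int A *v lin (x, y) = lin (lam * x + m * y, lam * y)"
    using lincomb[OF r(1) r(3)] lincomb[OF r(2) r(4)]
    by (simp add: vec_eq_iff forall_2 matrix_vector_mult_def sum_2 map_matrix_def)
  then show ?thesis by (simp add: proj_def toral_endo.abs_eq)
qed

section \<open>Hybrid Markov partitions\<close>

theorem theorem4p2:
  fixes A :: "int ^ 2 ^ 2"
  assumes "expanding_matrix A"
    and "\<not> diagonalizable_over_complex A"
  shows "\<exists>M. hybrid_markov_partition (toral_endo A) M"
proof -
  obtain lam m u1 u2 v1 v2 :: int where b: "2 \<le> \<bar>lam\<bar>" "m \<noteq> 0" "u1 * v2 - u2 * v1 = 1"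
    "A $ 1 $ 1 * u1 + A $ 1 $ 2 * u2 = lam * u1" "A $ 2 $ 1 * u1 + A $ 2 $ 2 * u2 = lam * u2"
    "A $ 1 $ 1 * v1 + A $ 1 $ 2 * v2 = lam * v1 + m * u1" "A $ 2 $ 1 * v1 + A $ 2 $ 2 * v2 = lam * v2 + m * u2"
    using nondiagonalizable_shear_basis[OF assms] .
  interpret basis: unimodular_basis "of_int u1" "of_int u2" "of_int v1" "of_int v2"
    by unfold_locales (auto simp: b(3) of_int_mult[symmetric] of_int_diff[symmetric] simp del: of_int_mult of_int_diff)
  interpret par: shear_parameters "of_int lam" "of_int m"
    by unfold_locales (use b in \<open>auto simp: of_int_abs[symmetric] simp del: of_int_abs\<close>)
  obtain n where n: "1 \<le> n" "4 * \<bar>of_int lam\<bar> * ((1 + 2 * \<bar>of_int m :: real\<bar> + real n * \<bar>of_int m\<bar>) / \<bar>of_int lam\<bar> ^ n) \<le> 1"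
    using par.fine_scale_exists by blast
  interpret sheared_endomorphism "of_int lam" "of_int m" basis.proj "toral_endo A" basis.distortion n
  proof
    show "toral_endo A (basis.proj (x, y)) = basis.proj (of_int lam * x + of_int m * y, of_int lam * y)" for x y
      by (rule toral_endo_proj[OF basis.unimodular_basis_axioms b(4-7)])
  qed (rule basis.continuous_proj basis.open_proj_image basis.surj_proj basis.proj_eq basis.distortion_pos
      basis.dist_proj_ge n | assumption)+
  have "\<not> piecewise_C1 (partition_boundary partition)"
    using boundary_not_Lipschitz C1_arc_Lipschitz unfolding piecewise_C1_def by metis
  moreover have "(\<lambda>t. basis.proj (t / 2, 0)) ` {0..1} \<subseteq> partition_boundary partition"
    using horizontal_circle_in_boundary by blast
  ultimately show ?thesis
    unfolding hybrid_markov_partition_def using markov basis.horizontal_C1_arc by blast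
qed

end
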